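(* Let $\alpha_0,\alpha$ be positive rationals and $\varphi(z)=\sum_{n\ge0}\frac{(\alpha)_n}{(\alpha+\alpha_0)_n}z^n$. Let $\theta>1$, $\vartheta>1$, and put \[ a_1=(\vartheta\, d\, s_0\,\epsilon(s_0)\,\epsilon(v))^{1/4}\,\tilde d\,\epsilon(s)\,e^{\theta(s_0/2+s+2v)},\qquad a_2=4\tilde d\,\epsilon(s)\,e^{\theta(r+s+2r_0+2u)}. \] Let $a\neq0$, $b\ge1$, $B\ge1$ be integers and $t\ge0$ real with \[ b\ge(a_1|a|)^6,\qquad B\le b^t. \] Define \[ M_0=\frac{\log b}{\log(a_1|a|)}\max\left\{6\frac{\log(a_2|a|)}{\log b}+\frac12,\ \frac{4t+1}{2},\ \frac14\cdot\frac{\log b}{\log(a_1|a|)},\ \frac{1+\max\{c(\theta),c(\vartheta),4\}}{2}\right\}. \] Then for every $n\in\mathbb{Z}$ and every integer $M\ge M_0$, \[ \left|\varphi\Big(\frac ab\Big)-\frac{n}{Bb^M}\right|\ge\frac{1}{Bb^M\,(a_1^{18}|a|^{17})^M}. \]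
   Context: Pochhammer symbol: $(x)_0=1$, $(x)_n=x(x+1)\cdots(x+n-1)$. Here $\varphi(a/b)$ is the real sum of the series (which converges since $|a/b|<1$). Write $\alpha_0=r_0/s_0$, $\alpha=r/s$, $\alpha_0+\alpha=u/v$ with positive integers in lowest terms; $d$ is the positive integer with $s_0s=dv$; $\tilde d=d/\gcd(d,s_0)$; $\epsilon(n)=\prod_{p\mid n}p^{1/(p-1)}$ (product over primes). $c(\theta)\ge2$ is a real number such that $\pi(x)\le\theta x/\log x$ for all $x\ge c(\theta)$ ($\pi(x)$ the number of primes $\le x$), and $c(\vartheta)>0$ is a real number such that $(n+1)^2<\vartheta^n$ for all integers $n\ge c(\vartheta)$. *)

theory Defs
  imports "HOL-Analysis.Analysis" "HOL-Computational_Algebra.Primes"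
begin

definition phi :: "real \<Rightarrow> real \<Rightarrow> real \<Rightarrow> real" where
  "phi alpha0 alpha z = (\<Sum>n. pochhammer alpha n / pochhammer (alpha + alpha0) n * z ^ n)"

definition eps :: "nat \<Rightarrow> real" where
  "eps n = (\<Prod>p\<in>prime_factors n. real p powr (1 / (real p - 1)))"

definition prime_pi :: "real \<Rightarrow> nat" where
  "prime_pi x = card {p :: nat. prime p \<and> real p \<le> x}"

end

theory Submission
  imports Defs "HOL-Computational_Algebra.Polynomial_FPS" "HOL-Number_Theory.Cong"
begin

text \<open>
  Write \<open>\<beta> = \<alpha> + \<alpha>\<^sub>0\<close>. The function \<open>\<phi>\<close> has explicit Pade approximants with denominator \<open>Q\<close> of degree \<open>m\<close>
  and numerator \<open>P\<close> of degree \<open>l\<close>: with a suitable choice of the coefficients of \<open>Q\<close>, the coefficients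
  of \<open>Q \<phi>\<close> at \<open>z\<close> to the powers \<open>l + 1, \<dots>, l + m\<close> are \<open>m\<close>-th differences of polynomials of degree \<open>m - 1\<close>.
  The common denominator \<open>D\<close> of all coefficients is at most exponential in \<open>l\<close>: the factors
  \<open>(x/s)\<^sub>i / i!\<close> only cost powers of \<open>s\<close>, and by partial fractions \<open>j! / (u/v)\<^sub>j\<close> only costs
  the least common multiple of \<open>1, \<dots>, u + l v\<close>, which is bounded by the hypothesis on \<open>\<pi>(x)\<close>.

  Take \<open>l \<ge> M + m\<close> and \<open>z = a/b\<close>. Then \<open>D B b\<^sup>l (P(z) - Q(z) n / (B b\<^sup>M))\<close> is an integer. It is nonzero for
  \<open>l = M + m\<close> or for \<open>l = M + m + 1\<close>, because the cross product of the two approximants is a nonzero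
  monomial in \<open>z\<close>. Since \<open>Q \<phi> - P\<close> is of size \<open>z\<close> to the power \<open>l + m + 1\<close>, the choice
  \<open>m = \<lfloor>4 M log (a\<^sub>1 |a|) / log b\<rfloor>\<close> makes it negligible, and the bound for \<open>\<phi>(a/b) - n / (B b\<^sup>M)\<close> follows.
\<close>

section \<open>Denominators of Pochhammer quotients\<close>

text \<open>Legendre's recursion: the multiples of \<open>p\<close> up to \<open>n\<close> are
  \<open>p\<close> times \<open>1, ..., n div p\<close>, and each gives one factor \<open>p\<close>
  besides those of its cofactor. In the induction both sides change only when \<open>p\<close>
  divides \<open>Suc n\<close>.\<close>

lemma multiplicity_fact_div:
  fixes p :: nat
  assumes p: "prime p"
  shows "multiplicity p (fact n :: nat) = n div p + multiplicity p (fact (n div p) :: nat)"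
proof (induction n)
  case (Suc n)
  have p0: "p > 0" using p by (simp add: prime_gt_0_nat)
  have step: "multiplicity p (fact (Suc n) :: nat) = multiplicity p (Suc n) + multiplicity p (fact n :: nat)"
    by (simp only: fact_Suc of_nat_id)
       (rule prime_elem_multiplicity_mult_distrib; use p in simp)
  show ?case
  proof (cases "p dvd Suc n")
    case False
    then have "Suc n div p = n div p" using p0 by (simp add: div_Suc dvd_eq_mod_eq_0)
    then show ?thesis using step Suc.IH False by (simp add: not_dvd_imp_multiplicity_0)
  next
    case True
    then obtain q where q: "Suc n = p * q" by blast
    then obtain q' where q': "q = Suc q'" by (cases q) auto
    have "Suc n div p = Suc (n div p)" using True p0 by (simp add: div_Suc dvd_eq_mod_eq_0)
    moreover have "Suc n div p = q" using q p0 by simp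
    ultimately have nd: "n div p = q'" "Suc n div p = Suc q'" using q' by auto
    have "multiplicity p (Suc n) = Suc (multiplicity p q)"
      unfolding q by (rule multiplicity_times_same) (use p q' in auto)
    moreover have "multiplicity p (fact (Suc q') :: nat) = multiplicity p (Suc q') + multiplicity p (fact q' :: nat)"
      by (simp only: fact_Suc of_nat_id)
         (rule prime_elem_multiplicity_mult_distrib; use p in simp)
    ultimately show ?thesis using step Suc.IH nd q' by simp
  qed
qed simp

text \<open>The recursion and the induction hypothesis give at most \<open>2 * (n div p)\<close>,
  and \<open>2 \<le> p\<close>. This crude bound serves the primes dividing \<open>s\<close>, for
  which \<open>s ^ n\<close> supplies \<open>n\<close> factors.\<close>

lemma multiplicity_fact_le:
  fixes p :: nat
  assumes p: "prime p"
  shows "multiplicity p (fact n :: nat) \<le> n"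
proof (induction n rule: less_induct)
  case (less n)
  have p2: "p \<ge> 2" using p by (rule prime_ge_2_nat)
  show ?case
  proof (cases "n = 0")
    case False
    then have "n div p < n" using p2 by simp
    then have "multiplicity p (fact (n div p) :: nat) \<le> n div p" by (rule less.IH)
    then have "multiplicity p (fact n :: nat) \<le> 2 * (n div p)"
      using multiplicity_fact_div[OF p, of n] by simp
    also have "\<dots> \<le> p * (n div p)" using p2 by simp
    also have "\<dots> \<le> n" by simp
    finally show ?thesis .
  qed simp
qed

text \<open>Compared prime by prime. If \<open>p\<close> divides \<open>s\<close>, the power of
  \<open>s\<close> is enough. Otherwise \<open>s\<close> is invertible modulo powers of
  \<open>p\<close>, so the progression behaves like \<open>n\<close> consecutive integers, whose
  product is a multiple of \<open>fact n\<close>.\<close>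

lemma fact_dvd_power_mult_arith_prod:
  fixes s x :: nat
  assumes s: "s > 0" and x: "x > 0"
  shows "fact n dvd s ^ n * (\<Prod>j<n. x + j * s)"
proof (rule multiplicity_le_imp_dvd)
  show "(fact n :: nat) \<noteq> 0" by simp
next
  fix p :: nat
  assume p: "prime p"
  have nz: "s ^ n \<noteq> 0" "(\<Prod>j<n. x + j * s) \<noteq> 0" using s x by auto
  have md: "multiplicity p (s ^ n * (\<Prod>j<n. x + j * s))
      = multiplicity p (s ^ n) + multiplicity p (\<Prod>j<n. x + j * s)"
    by (rule prime_elem_multiplicity_mult_distrib) (use p nz in auto)
  show "multiplicity p (fact n) \<le> multiplicity p (s ^ n * (\<Prod>j<n. x + j * s))"
  proof (cases "p dvd s")
    case True
    then have "p ^ n dvd s ^ n" by (rule dvd_power_same)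
    then have "n \<le> multiplicity p (s ^ n)"
      using nz(1) p by (intro multiplicity_geI) (auto simp: not_prime_unit)
    then show ?thesis using md multiplicity_fact_le[OF p, of n] by linarith
  next
    case False
    define e where "e = multiplicity p (fact n :: nat)"
    have cop: "coprime s (p ^ e)"
      using False p by (simp add: coprime_commute prime_imp_coprime)
    \<comment> \<open>With \<open>t\<close> inverse to \<open>s\<close>, each term
      \<open>x + j * s\<close> is congruent to \<open>s * (x * t + j)\<close>.\<close>
    obtain t where t: "[s * t = 1] (mod p ^ e)" using cong_solve_coprime_nat[OF cop] by auto
    have "[(\<Prod>j<n. x + j * s) = (\<Prod>j<n. s * (x * t + j))] (mod p ^ e)"
    proof (rule cong_prod)
      fix j
      have "[x * 1 + j * s = x * (s * t) + j * s] (mod p ^ e)"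
        by (intro cong_add cong_mult cong_refl cong_sym[OF t])
      then show "[x + j * s = s * (x * t + j)] (mod p ^ e)" by (simp add: algebra_simps)
    qed
    moreover have "p ^ e dvd (\<Prod>j<n. s * (x * t + j))"
    proof -
      have "int (fact n) dvd int (pochhammer (x * t) n)"
        using fact_dvd_pochhammer[of n "int (x * t)"]
        by (simp only: pochhammer_of_nat of_nat_fact)
      then have "(fact n :: nat) dvd pochhammer (x * t) n" by presburger
      also have "pochhammer (x * t) n = (\<Prod>j<n. x * t + j)"
        by (simp add: pochhammer_prod atLeast0LessThan)
      also have "\<dots> dvd (\<Prod>j<n. s * (x * t + j))" by (simp add: prod.distrib)
      finally show ?thesis unfolding e_def using multiplicity_dvd dvd_trans by blast
    qed
    ultimately have "p ^ e dvd (\<Prod>j<n. x + j * s)" using cong_dvd_iff by blast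
    then have "e \<le> multiplicity p (\<Prod>j<n. x + j * s)"
      using nz(2) p by (intro multiplicity_geI) (auto simp: not_prime_unit)
    then show ?thesis using md unfolding e_def by linarith
  qed
qed

lemma pochhammer_divide_of_nat:
  fixes s x :: nat
  assumes s: "s > 0"
  shows "pochhammer (real x / real s) n = real (\<Prod>j<n. x + j * s) / real s ^ n"
proof (induction n)
  case (Suc n)
  then show ?case using s by (simp add: pochhammer_Suc field_simps)
qed simp

text \<open>One factor \<open>s ^ n\<close> clears the denominators inside the Pochhammer symbol,
  the other makes the numerator divisible by \<open>fact n\<close>.\<close>

lemma pochhammer_over_fact_in_Ints:
  fixes s x :: nat
  assumes s: "s > 0" and x: "x > 0"
  shows "real s ^ (2 * n) * (pochhammer (real x / real s) n / fact n) \<in> \<int>"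
proof -
  obtain c where c: "s ^ n * (\<Prod>j<n. x + j * s) = fact n * c"
    using fact_dvd_power_mult_arith_prod[OF s x, of n] by blast
  have "real s ^ (2 * n) * (pochhammer (real x / real s) n / fact n)
      = real (s ^ n * (\<Prod>j<n. x + j * s)) / fact n"
    using s unfolding pochhammer_divide_of_nat[OF s] by (simp add: field_simps power_mult power2_eq_square)
  also have "\<dots> = real c" unfolding c by simp
  finally show ?thesis by simp
qed

section \<open>The least common multiple of the first N integers\<close>

text \<open>The product, over the primes \<open>p \<le> N\<close>, of the largest power of
  \<open>p\<close> not exceeding \<open>N\<close> is a common multiple, and each of its factors is
  at most \<open>N\<close>.\<close>

lemma Lcm_upto_le:
  assumes N: "N \<ge> 1"
  shows "Lcm {1..N} \<le> N ^ card {p::nat. prime p \<and> p \<le> N}"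
proof -
  define P where "P = {p::nat. prime p \<and> p \<le> N}"
  define e where "e p = Max {e. p ^ e \<le> N}" for p :: nat
  have finP: "finite P" unfolding P_def by (rule finite_subset[of _ "{..N}"]) auto
  have fin: "finite {e. p ^ e \<le> N}" if "p \<in> P" for p
  proof (rule finite_subset[of _ "{..N}"])
    have "e \<le> N" if "p ^ e \<le> N" for e
    proof -
      have "2 \<le> p" using \<open>p \<in> P\<close> by (auto simp: P_def prime_ge_2_nat)
      then have "e < p ^ e" by (meson less_exp order_less_le_trans power_mono zero_le)
      then show ?thesis using that by simp
    qed
    then show "{e. p ^ e \<le> N} \<subseteq> {..N}" by auto
  qed simp
  have eN: "p ^ e p \<le> N" if "p \<in> P" for p
  proof -
    have "e p \<in> {e. p ^ e \<le> N}" unfolding e_def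
      by (rule Max_in[OF fin[OF that]]) (use N in \<open>auto intro!: exI[of _ 0]\<close>)
    then show ?thesis by simp
  qed
  have "k dvd (\<Prod>p\<in>P. p ^ e p)" if k: "k \<in> {1..N}" for k
  proof -
    have k0: "k > 0" using k by auto
    have le: "multiplicity p k \<le> e p" and inP: "p \<in> P" if p: "p \<in> prime_factors k" for p
    proof -
      have "p \<le> k" using p k0 by (auto intro!: dvd_imp_le)
      then show "p \<in> P" using p k by (auto simp: P_def)
      have "p ^ multiplicity p k \<le> k" using k0 by (intro dvd_imp_le multiplicity_dvd) auto
      then have "multiplicity p k \<in> {e. p ^ e \<le> N}" using k by auto
      then show "multiplicity p k \<le> e p" unfolding e_def by (rule Max_ge[OF fin[OF \<open>p \<in> P\<close>]])
    qed
    have "k = (\<Prod>p\<in>prime_factors k. p ^ multiplicity p k)"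
      using k0 by (simp add: prime_factorization_nat)
    also have "\<dots> dvd (\<Prod>p\<in>P. p ^ e p)"
      by (rule prod_dvd_prod_subset2[OF finP]) (use le inP in \<open>auto intro: le_imp_power_dvd\<close>)
    finally show ?thesis .
  qed
  then have "Lcm {1..N} dvd (\<Prod>p\<in>P. p ^ e p)" by (rule Lcm_least)
  then have "Lcm {1..N} \<le> (\<Prod>p\<in>P. p ^ e p)"
    by (rule dvd_imp_le) (auto intro!: prod_pos simp: P_def prime_gt_0_nat)
  also have "\<dots> \<le> (\<Prod>p\<in>P. N)" by (rule prod_mono) (use eN in auto)
  finally show ?thesis by (simp add: P_def)
qed

lemma Lcm_upto_le_exp:
  assumes N: "N \<ge> 2" and pi: "real (prime_pi (real N)) \<le> th * real N / ln (real N)"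
  shows "real (Lcm {1..N}) \<le> exp (th * real N)"
proof -
  have ln: "ln (real N) > 0" using N by simp
  have "real (Lcm {1..N}) \<le> real N ^ prime_pi (real N)"
    using Lcm_upto_le[of N] N unfolding prime_pi_def of_nat_le_iff
    by (metis of_nat_le_iff of_nat_power one_le_numeral order_trans)
  also have "\<dots> = exp (real (prime_pi (real N)) * ln (real N))"
    using N by (simp add: exp_of_nat_mult)
  also have "\<dots> \<le> exp (th * real N)"
    using pi ln by (simp add: field_simps)
  finally show ?thesis .
qed

section \<open>Alternating binomial sums\<close>

text \<open>Up to the sign \<open>(-1) ^ m\<close> this is the \<open>m\<close>-th forward
  difference of \<open>f\<close> at 0.\<close>

definition alt_binom_sum :: "nat \<Rightarrow> (nat \<Rightarrow> real) \<Rightarrow> real" where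
  "alt_binom_sum m f = (\<Sum>i\<le>m. (-1) ^ i * real (m choose i) * f i)"

text \<open>Pascal's rule.\<close>

lemma alt_binom_sum_Suc:
  "alt_binom_sum (Suc m) f = alt_binom_sum m f - alt_binom_sum m (\<lambda>i. f (Suc i))"
proof -
  have "alt_binom_sum (Suc m) f
      = f 0 + (\<Sum>i\<le>m. (-1) ^ Suc i * real (Suc m choose Suc i) * f (Suc i))"
    unfolding alt_binom_sum_def by (subst sum.atMost_Suc_shift) simp
  also have "(\<Sum>i\<le>m. (-1) ^ Suc i * real (Suc m choose Suc i) * f (Suc i))
      = (\<Sum>i\<le>m. (-1) ^ Suc i * real (m choose Suc i) * f (Suc i)) - alt_binom_sum m (\<lambda>i. f (Suc i))"
    unfolding alt_binom_sum_def sum_subtractf[symmetric]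
    by (rule sum.cong) (simp_all add: algebra_simps)
  also have "f 0 + ((\<Sum>i\<le>m. (-1) ^ Suc i * real (m choose Suc i) * f (Suc i)) - alt_binom_sum m (\<lambda>i. f (Suc i)))
      = (\<Sum>i\<le>Suc m. (-1) ^ i * real (m choose i) * f i) - alt_binom_sum m (\<lambda>i. f (Suc i))"
    by (subst sum.atMost_Suc_shift) simp
  finally show ?thesis by (simp add: alt_binom_sum_def)
qed

lemma alt_binom_sum_add: "alt_binom_sum m (\<lambda>i. f i + g i) = alt_binom_sum m f + alt_binom_sum m g"
  by (simp add: alt_binom_sum_def algebra_simps sum.distrib)

lemma alt_binom_sum_cmult: "alt_binom_sum m (\<lambda>i. c * f i) = c * alt_binom_sum m f"
  by (simp add: alt_binom_sum_def algebra_simps sum_distrib_left)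

text \<open>Absorption: \<open>i\<close> times \<open>m + 1\<close> choose \<open>i\<close> is
  \<open>m + 1\<close> times \<open>m\<close> choose \<open>i - 1\<close>. A factor \<open>i\<close>
  thus lowers the order by one and shifts the argument.\<close>

lemma alt_binom_sum_of_nat_mult:
  "alt_binom_sum (Suc m) (\<lambda>i. real i * f i) = - real (Suc m) * alt_binom_sum m (\<lambda>i. f (Suc i))"
proof -
  have *: "real (Suc m choose Suc i) * real (Suc i) = real (Suc m) * real (m choose i)" for i
    using Suc_times_binomial_eq[of m i] by (metis mult.commute of_nat_mult)
  have "alt_binom_sum (Suc m) (\<lambda>i. real i * f i)
     = (\<Sum>i\<le>m. (-1) ^ Suc i * (real (Suc m choose Suc i) * real (Suc i)) * f (Suc i))"
    unfolding alt_binom_sum_def by (subst sum.atMost_Suc_shift) (simp add: mult_ac)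
  also have "\<dots> = - real (Suc m) * alt_binom_sum m (\<lambda>i. f (Suc i))"
    unfolding * alt_binom_sum_def sum_distrib_left by (rule sum.cong) (simp_all add: algebra_simps)
  finally show ?thesis .
qed

text \<open>An \<open>m\<close>-th difference kills polynomials of degree below \<open>m\<close>.
  Splitting off the last factor \<open>x k - i\<close> leaves a sum of order \<open>m\<close> and,
  by absorption, one of order \<open>m - 1\<close> with all \<open>x j\<close> shifted by 1; hence
  the generalisation over \<open>m\<close> and \<open>x\<close>.\<close>

lemma alt_binom_sum_prod_eq_0:
  "k < m \<Longrightarrow> alt_binom_sum m (\<lambda>i. \<Prod>j<k. x j - real i) = 0"
proof (induction k arbitrary: m x)
  case 0
  then show ?case
    using choose_alternating_sum[of m, where ?'a = real] by (simp add: alt_binom_sum_def)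
next
  case (Suc k)
  then obtain m' where m: "m = Suc m'" and k: "k < m'" by (cases m) auto
  have "(\<lambda>i. \<Prod>j<Suc k. x j - real i)
      = (\<lambda>i. x k * (\<Prod>j<k. x j - real i) + (-1) * (real i * (\<Prod>j<k. x j - real i)))"
    by (simp add: algebra_simps)
  then have "alt_binom_sum m (\<lambda>i. \<Prod>j<Suc k. x j - real i)
     = x k * alt_binom_sum m (\<lambda>i. \<Prod>j<k. x j - real i)
       + (-1) * (- real m * alt_binom_sum m' (\<lambda>i. \<Prod>j<k. (x j - 1) - real i))"
    by (simp only: alt_binom_sum_add alt_binom_sum_cmult m alt_binom_sum_of_nat_mult)
       (simp add: algebra_simps)
  also have "alt_binom_sum m (\<lambda>i. \<Prod>j<k. x j - real i) = 0" using Suc by simp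
  also have "alt_binom_sum m' (\<lambda>i. \<Prod>j<k. (x j - 1) - real i) = 0" using Suc.IH[OF k] by simp
  finally show ?case by simp
qed

text \<open>The partial fraction expansion of the right-hand side in \<open>y\<close>, proved with
  Pascal's rule: the two sums of order \<open>m\<close> are those at \<open>y\<close> and at
  \<open>y - 1\<close>.\<close>

lemma alt_binom_sum_inverse:
  assumes "\<And>j. j \<le> m \<Longrightarrow> y \<noteq> real j"
  shows "alt_binom_sum m (\<lambda>i. 1 / (y - real i)) = (-1) ^ m * fact m / (\<Prod>j\<le>m. y - real j)"
  using assms
proof (induction m arbitrary: y)
  case 0
  then show ?case by (simp add: alt_binom_sum_def)
next
  case (Suc m)
  define W where "W = (\<Prod>j<m. y - 1 - real j)"
  have p1: "(\<Prod>j\<le>m. y - real j) = y * W"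
    unfolding W_def lessThan_Suc_atMost[symmetric] by (subst prod.lessThan_Suc_shift) (simp add: algebra_simps)
  have p2: "(\<Prod>j\<le>m. (y - 1) - real j) = W * (y - 1 - real m)"
    unfolding W_def lessThan_Suc_atMost[symmetric] by simp
  have p3: "(\<Prod>j\<le>Suc m. y - real j) = y * W * (y - 1 - real m)"
    using p1 by (simp add: algebra_simps)
  have "y - real j \<noteq> 0" if "j \<le> Suc m" for j using Suc.prems[OF that] by simp
  then have "(\<Prod>j\<le>Suc m. y - real j) \<noteq> 0" by (subst prod_zero_iff) auto
  then have nz: "y \<noteq> 0" "W \<noteq> 0" "y - 1 - real m \<noteq> 0" unfolding p3 by auto
  have a: "alt_binom_sum m (\<lambda>i. 1 / (y - real i)) = (-1) ^ m * fact m / (y * W)"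
    unfolding p1[symmetric] by (rule Suc.IH) (use Suc.prems in auto)
  have "y - 1 \<noteq> real j" if "j \<le> m" for j using Suc.prems[of "Suc j"] that by auto
  then have "alt_binom_sum m (\<lambda>i. 1 / ((y - 1) - real i)) = (-1) ^ m * fact m / (W * (y - 1 - real m))"
    unfolding p2[symmetric] by (rule Suc.IH)
  then have b: "alt_binom_sum m (\<lambda>i. 1 / (y - real (Suc i))) = (-1) ^ m * fact m / (W * (y - 1 - real m))"
    by (simp add: algebra_simps)
  \<comment> \<open>Writing \<open>m + 1\<close> as \<open>y - Y\<close> makes the difference of the
    two fractions combine into a single one.\<close>
  define Y where "Y = y - 1 - real m"
  have "fact (Suc m) = (y - Y) * fact m" by (simp add: Y_def)
  then show ?case
    unfolding alt_binom_sum_Suc a b p3 using nz unfolding Y_def[symmetric]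
    by (simp add: divide_simps del: fact_Suc) (simp add: algebra_simps)
qed

text \<open>Each factor is \<open>x j - i = (x j - y) + (y - i)\<close>. The second summand cancels
  the denominator and leaves a polynomial of degree below \<open>m\<close>, which the sum kills; so
  the numerator may be evaluated at \<open>i = y\<close>.\<close>

lemma alt_binom_sum_prod_divide:
  assumes "k \<le> m" and y: "\<And>j. j \<le> m \<Longrightarrow> y \<noteq> real j"
  shows "alt_binom_sum m (\<lambda>i. (\<Prod>j<k. x j - real i) / (y - real i))
       = (\<Prod>j<k. x j - y) * alt_binom_sum m (\<lambda>i. 1 / (y - real i))"
  using assms(1)
proof (induction k)
  case (Suc k)
  have "alt_binom_sum m (\<lambda>i. (\<Prod>j<Suc k. x j - real i) / (y - real i))
      = alt_binom_sum m (\<lambda>i. (\<Prod>j<k. x j - real i) + (x k - y) * ((\<Prod>j<k. x j - real i) / (y - real i)))"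
    unfolding alt_binom_sum_def
  proof (rule sum.cong[OF refl])
    fix i assume "i \<in> {..m}"
    then have "y - real i \<noteq> 0" using y[of i] by auto
    then show "(-1) ^ i * real (m choose i) * ((\<Prod>j<Suc k. x j - real i) / (y - real i))
       = (-1) ^ i * real (m choose i) * ((\<Prod>j<k. x j - real i) + (x k - y) * ((\<Prod>j<k. x j - real i) / (y - real i)))"
      by (simp add: field_simps)
  qed
  also have "\<dots> = (x k - y) * alt_binom_sum m (\<lambda>i. (\<Prod>j<k. x j - real i) / (y - real i))"
    unfolding alt_binom_sum_add alt_binom_sum_cmult using Suc.prems by (simp add: alt_binom_sum_prod_eq_0)
  also have "\<dots> = (\<Prod>j<Suc k. x j - y) * alt_binom_sum m (\<lambda>i. 1 / (y - real i))"
    using Suc by simp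
  finally show ?case .
qed simp

text \<open>Partial fractions write the quotient as an integer combination of the numbers
  \<open>v / (u + i * v)\<close> with \<open>i < n\<close>, and every \<open>u + i * v\<close>
  divides the least common multiple.\<close>

lemma Lcm_fact_over_pochhammer_in_Ints:
  fixes u v :: nat
  assumes u: "u > 0" and v: "v > 0" and N: "u + n * v \<le> N"
  shows "real (Lcm {1..N}) * (fact n / pochhammer (real u / real v) n) \<in> \<int>"
proof (cases n)
  case (Suc k)
  \<comment> \<open>With this \<open>y\<close> the factors \<open>y - j\<close> are the Pochhammer
    factors \<open>u / v + j\<close> with opposite sign.\<close>
  define y where "y = - (real u / real v)"
  have "y < 0" using u v by (simp add: y_def)
  then have ny: "y \<noteq> real j" for j by (metis not_less of_nat_0_le_iff)
  have "(\<Prod>j\<le>k. y - real j) = (-1) ^ Suc k * pochhammer (real u / real v) (Suc k)"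
  proof (induction k)
    case (Suc k)
    then show ?case by (simp add: pochhammer_Suc[of _ "Suc k"]) (simp add: y_def algebra_simps)
  qed (simp add: y_def)
  with alt_binom_sum_inverse[of k y] ny
  have eq: "fact k / pochhammer (real u / real v) (Suc k) = - alt_binom_sum k (\<lambda>i. 1 / (y - real i))"
    by simp
  have int: "real (Lcm {1..N}) * (1 / (y - real i)) \<in> \<int>" if "i \<le> k" for i
  proof -
    have "u + i * v \<le> N"
      using that N Suc by (meson add_left_mono le_SucI le_trans mult_le_mono1)
    then have "u + i * v \<in> {1..N}" using u by auto
    then obtain c where c: "Lcm {1..N} = (u + i * v) * c" using dvd_Lcm by blast
    have "1 / (y - real i) = - real v / real (u + i * v)"
      using u v by (simp add: y_def divide_simps) (simp add: algebra_simps)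
    then have "real (Lcm {1..N}) * (1 / (y - real i)) = - real v * real c"
      using u unfolding c by (simp del: of_nat_add)
    then show ?thesis by simp
  qed
  have "real (Lcm {1..N}) * (fact n / pochhammer (real u / real v) n)
     = - real (Suc k) * (real (Lcm {1..N}) * alt_binom_sum k (\<lambda>i. 1 / (y - real i)))"
  proof -
    have "fact n / pochhammer (real u / real v) n = real (Suc k) * (fact k / pochhammer (real u / real v) (Suc k))"
      unfolding Suc by simp
    then show ?thesis unfolding eq by (simp only: mult_minus_left mult_minus_right mult_ac)
  qed
  also have "real (Lcm {1..N}) * alt_binom_sum k (\<lambda>i. 1 / (y - real i))
     = (\<Sum>i\<le>k. (-1) ^ i * real (k choose i) * (real (Lcm {1..N}) * (1 / (y - real i))))"
    by (simp add: alt_binom_sum_def sum_distrib_left mult_ac)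
  also have "- real (Suc k) * \<dots> \<in> \<int>"
    by (intro Ints_mult Ints_sum int Ints_power Ints_minus) auto
  finally show ?thesis .
qed simp

section \<open>Pade approximants\<close>

definition poch_ratio :: "real \<Rightarrow> real \<Rightarrow> nat \<Rightarrow> real" where
  "poch_ratio \<alpha> \<beta> n = pochhammer \<alpha> n / pochhammer \<beta> n"

text \<open>
  \<open>pade_coeff \<alpha> \<beta> l m i\<close> is the \<open>i\<close>-th coefficient of the Pade denominator, and \<open>pade_prod \<alpha> \<beta> l m k\<close>
  is the \<open>k\<close>-th coefficient of its product with \<open>\<phi>\<close>.
\<close>

definition pade_coeff :: "real \<Rightarrow> real \<Rightarrow> nat \<Rightarrow> nat \<Rightarrow> nat \<Rightarrow> real" where
  "pade_coeff \<alpha> \<beta> l m i = (if i \<le> m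
     then (-1) ^ i * (pochhammer (\<beta> + real l) (m - i) / fact (m - i))
            * (pochhammer (\<alpha> + real l + 1 - real i) i / fact i)
     else 0)"

definition pade_prod :: "real \<Rightarrow> real \<Rightarrow> nat \<Rightarrow> nat \<Rightarrow> nat \<Rightarrow> real" where
  "pade_prod \<alpha> \<beta> l m k = (\<Sum>i\<le>k. pade_coeff \<alpha> \<beta> l m i * poch_ratio \<alpha> \<beta> (k - i))"

definition pade_den :: "real \<Rightarrow> real \<Rightarrow> nat \<Rightarrow> nat \<Rightarrow> real poly" where
  "pade_den \<alpha> \<beta> l m = (\<Sum>i\<le>m. monom (pade_coeff \<alpha> \<beta> l m i) i)"

definition pade_num :: "real \<Rightarrow> real \<Rightarrow> nat \<Rightarrow> nat \<Rightarrow> real poly" where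
  "pade_num \<alpha> \<beta> l m = (\<Sum>k\<le>l. monom (pade_prod \<alpha> \<beta> l m k) k)"

text \<open>This one quantity bounds both the denominator on \<open>\<bar>z\<bar> \<le> 1\<close>
  and the coefficients of index at least \<open>m\<close> of its product with the series, since
  \<open>poch_ratio\<close> lies between 0 and 1 for \<open>0 < \<alpha> < \<beta>\<close>.\<close>

definition pade_height :: "real \<Rightarrow> real \<Rightarrow> nat \<Rightarrow> nat \<Rightarrow> real" where
  "pade_height \<alpha> \<beta> l m = (\<Sum>i\<le>m. \<bar>pade_coeff \<alpha> \<beta> l m i\<bar>)"

section \<open>Coefficients of the approximants and of the product with the series\<close>

lemma coeff_sum_monom: "coeff (\<Sum>i\<le>n. monom (f i) i) k = (if k \<le> n then f k else 0)"
  by (simp add: coeff_sum)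

lemma coeff_pade_den: "coeff (pade_den \<alpha> \<beta> l m) i = pade_coeff \<alpha> \<beta> l m i"
  unfolding pade_den_def coeff_sum_monom by (simp add: pade_coeff_def)

lemma coeff_pade_num: "coeff (pade_num \<alpha> \<beta> l m) k = (if k \<le> l then pade_prod \<alpha> \<beta> l m k else 0)"
  unfolding pade_num_def coeff_sum_monom ..

lemma degree_pade_den: "degree (pade_den \<alpha> \<beta> l m) \<le> m"
  by (rule degree_le) (simp add: coeff_pade_den pade_coeff_def)

lemma degree_pade_num: "degree (pade_num \<alpha> \<beta> l m) \<le> l"
  by (rule degree_le) (simp add: coeff_pade_num)

text \<open>Pulling out what does not depend on \<open>i\<close> exposes the binomial weights, so
  that products with the series become values of \<open>alt_binom_sum\<close>. The condition
  \<open>m \<le> Suc l\<close> keeps \<open>Suc l - i\<close> from being truncated.\<close>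

lemma pade_coeff_eq:
  assumes "\<alpha> > 0" "\<beta> > 0" "i \<le> m" "m \<le> Suc l"
  shows "pade_coeff \<alpha> \<beta> l m i
    = pochhammer \<alpha> (Suc l) / (pochhammer \<beta> l * fact m) * ((-1) ^ i * real (m choose i)
       * (pochhammer \<beta> (l + m - i) / pochhammer \<alpha> (Suc l - i)))"
proof -
  have "pochhammer \<beta> (l + m - i) = pochhammer \<beta> l * pochhammer (\<beta> + real l) (m - i)"
    using pochhammer_product'[of \<beta> l "m - i"] assms by simp
  moreover have "pochhammer \<alpha> (Suc l) = pochhammer \<alpha> (Suc l - i) * pochhammer (\<alpha> + real l + 1 - real i) i"
    using pochhammer_product'[of \<alpha> "Suc l - i" i] assms by (simp add: of_nat_diff algebra_simps)
  moreover have "pochhammer \<beta> l \<noteq> 0" "pochhammer \<alpha> (Suc l - i) \<noteq> 0"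
    using assms by (auto simp: less_imp_neq[symmetric] pochhammer_pos)
  moreover have "real (m choose i) = fact m / (fact i * fact (m - i))"
    using assms by (simp add: binomial_fact)
  ultimately show ?thesis using assms by (simp add: pade_coeff_def mult_ac)
qed

lemma pade_prod_eq_sum:
  assumes "m \<le> k"
  shows "pade_prod \<alpha> \<beta> l m k = (\<Sum>i\<le>m. pade_coeff \<alpha> \<beta> l m i * poch_ratio \<alpha> \<beta> (k - i))"
  unfolding pade_prod_def by (rule sum.mono_neutral_right) (use assms in \<open>auto simp: pade_coeff_def\<close>)

text \<open>For \<open>k > l\<close> the symbol \<open>pochhammer \<alpha> (k - i)\<close> contains
  the denominator \<open>pochhammer \<alpha> (Suc l - i)\<close> of the coefficient; what remains is
  a product of \<open>k - l - 1\<close> factors linear in \<open>i\<close>.\<close>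

lemma pade_prod_eq_alt_binom_sum:
  assumes "\<alpha> > 0" "\<beta> > 0" "m \<le> Suc l" "l < k"
  shows "pade_prod \<alpha> \<beta> l m k = pochhammer \<alpha> (Suc l) / (pochhammer \<beta> l * fact m) *
     alt_binom_sum m (\<lambda>i. (\<Prod>j<k - Suc l. (\<alpha> + real (Suc l + j)) - real i)
        * (pochhammer \<beta> (l + m - i) / pochhammer \<beta> (k - i)))"
proof -
  have *: "poch_ratio \<alpha> \<beta> (k - i)
      = (\<Prod>j<k - Suc l. (\<alpha> + real (Suc l + j)) - real i) * (pochhammer \<alpha> (Suc l - i) / pochhammer \<beta> (k - i))"
    if "i \<le> m" for i
  proof -
    have "k - i = (Suc l - i) + (k - Suc l)" using that assms by auto
    then have "pochhammer \<alpha> (k - i) = pochhammer \<alpha> (Suc l - i) * pochhammer (\<alpha> + real (Suc l - i)) (k - Suc l)"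
      by (simp only: pochhammer_product')
    also have "pochhammer (\<alpha> + real (Suc l - i)) (k - Suc l) = (\<Prod>j<k - Suc l. (\<alpha> + real (Suc l + j)) - real i)"
      using that assms unfolding pochhammer_prod atLeast0LessThan
      by (intro prod.cong) (auto simp: of_nat_diff)
    finally show ?thesis by (simp add: poch_ratio_def)
  qed
  have nz: "pochhammer \<alpha> n \<noteq> 0" for n using pochhammer_pos[of \<alpha> n] assms by auto
  have "pade_prod \<alpha> \<beta> l m k = (\<Sum>i\<le>m. pade_coeff \<alpha> \<beta> l m i * poch_ratio \<alpha> \<beta> (k - i))"
    by (rule pade_prod_eq_sum) (use assms in auto)
  also have "\<dots> = (\<Sum>i\<le>m. pochhammer \<alpha> (Suc l) / (pochhammer \<beta> l * fact m) * ((-1) ^ i * real (m choose i)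
       * ((\<Prod>j<k - Suc l. (\<alpha> + real (Suc l + j)) - real i)
        * (pochhammer \<beta> (l + m - i) / pochhammer \<beta> (k - i)))))"
  proof (rule sum.cong[OF refl])
    fix i assume "i \<in> {..m}"
    then have i: "i \<le> m" by simp
    show "pade_coeff \<alpha> \<beta> l m i * poch_ratio \<alpha> \<beta> (k - i) = pochhammer \<alpha> (Suc l) / (pochhammer \<beta> l * fact m) *
         ((-1) ^ i * real (m choose i) * ((\<Prod>j<k - Suc l. (\<alpha> + real (Suc l + j)) - real i)
          * (pochhammer \<beta> (l + m - i) / pochhammer \<beta> (k - i))))"
      unfolding pade_coeff_eq[OF assms(1,2) i assms(3)] *[OF i] using nz[of "Suc l - i"] by simp
  qed
  finally show ?thesis by (simp add: alt_binom_sum_def sum_distrib_left)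
qed

lemma prod_lessThan_add:
  fixes f :: "nat \<Rightarrow> 'a :: comm_monoid_mult"
  shows "(\<Prod>j<a + b. f j) = (\<Prod>j<a. f j) * (\<Prod>j<b. f (a + j))"
  by (induction b) (simp_all add: mult_ac)

text \<open>In this range the quotient of the two \<open>\<beta>\<close>-symbols is itself a product
  of \<open>l + m - k\<close> linear factors, so the summand is a polynomial in \<open>i\<close> of
  degree \<open>m - 1\<close>.\<close>

lemma pade_prod_eq_0:
  assumes "\<alpha> > 0" "\<beta> > 0" "m \<le> Suc l" "l < k" "k \<le> l + m"
  shows "pade_prod \<alpha> \<beta> l m k = 0"
proof -
  \<comment> \<open>All \<open>m - 1\<close> linear factors in one sequence: first those from
    \<open>\<alpha>\<close>, then those from \<open>\<beta>\<close>.\<close>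
  define x where "x j = (if j < k - Suc l then \<alpha> + real (Suc l + j) else \<beta> + real (j + Suc l))" for j
  have m: "m - 1 = (k - Suc l) + (l + m - k)" "m - 1 < m" using assms by auto
  have eq: "(\<Prod>j<k - Suc l. (\<alpha> + real (Suc l + j)) - real i)
        * (pochhammer \<beta> (l + m - i) / pochhammer \<beta> (k - i)) = (\<Prod>j<m - 1. x j - real i)"
    if i: "i \<le> m" for i
  proof -
    have "l + m - i = (k - i) + (l + m - k)" using i assms by auto
    then have "pochhammer \<beta> (l + m - i) = pochhammer \<beta> (k - i) * pochhammer (\<beta> + real (k - i)) (l + m - k)"
      by (simp only: pochhammer_product')
    moreover have "pochhammer \<beta> (k - i) \<noteq> 0" using pochhammer_pos[of \<beta> "k - i"] assms by auto
    moreover have "pochhammer (\<beta> + real (k - i)) (l + m - k)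
        = (\<Prod>j<l + m - k. x ((k - Suc l) + j) - real i)"
      unfolding pochhammer_prod atLeast0LessThan
      by (intro prod.cong) (use i assms in \<open>auto simp: of_nat_diff x_def\<close>)
    moreover have "(\<Prod>j<k - Suc l. (\<alpha> + real (Suc l + j)) - real i) = (\<Prod>j<k - Suc l. x j - real i)"
      by (intro prod.cong) (auto simp: x_def)
    moreover have "(\<Prod>j<m - 1. x j - real i)
        = (\<Prod>j<k - Suc l. x j - real i) * (\<Prod>j<l + m - k. x ((k - Suc l) + j) - real i)"
      unfolding m(1) by (rule prod_lessThan_add)
    ultimately show ?thesis by simp
  qed
  have "alt_binom_sum m (\<lambda>i. (\<Prod>j<k - Suc l. (\<alpha> + real (Suc l + j)) - real i)
        * (pochhammer \<beta> (l + m - i) / pochhammer \<beta> (k - i))) = alt_binom_sum m (\<lambda>i. \<Prod>j<m - 1. x j - real i)"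
    unfolding alt_binom_sum_def by (rule sum.cong) (use eq in auto)
  also have "\<dots> = 0" by (rule alt_binom_sum_prod_eq_0[OF m(2)])
  finally show ?thesis using pade_prod_eq_alt_binom_sum[OF assms(1-4)] by simp
qed

text \<open>One index past the gap the \<open>\<beta>\<close>-quotient becomes
  \<open>1 / (y - i)\<close>, so the sum has a closed form. Its factors
  \<open>\<alpha> + (l + 1 + j) - y\<close> with \<open>j < m\<close> are negative because
  \<open>\<alpha> < \<beta>\<close>.\<close>

lemma pade_prod_neq_0:
  assumes "\<alpha> > 0" "\<beta> > \<alpha>" "m \<le> Suc l"
  shows "pade_prod \<alpha> \<beta> l m (l + m + 1) \<noteq> 0"
proof -
  have b: "\<beta> > 0" using assms by simp
  define y where "y = \<beta> + real (l + m)"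
  have y: "y \<noteq> real j" if "j \<le> m" for j using b that by (auto simp: y_def)
  have eq: "pochhammer \<beta> (l + m - i) / pochhammer \<beta> (l + m + 1 - i) = 1 / (y - real i)" if i: "i \<le> m" for i
  proof -
    have "l + m + 1 - i = Suc (l + m - i)" using i by auto
    moreover have "pochhammer \<beta> (l + m - i) \<noteq> 0" using pochhammer_pos[of \<beta> "l + m - i"] b by auto
    ultimately show ?thesis using i by (simp add: pochhammer_Suc of_nat_diff y_def add_diff_eq)
  qed
  have "alt_binom_sum m (\<lambda>i. (\<Prod>j<m. (\<alpha> + real (Suc l + j)) - real i)
        * (pochhammer \<beta> (l + m - i) / pochhammer \<beta> (l + m + 1 - i)))
      = alt_binom_sum m (\<lambda>i. (\<Prod>j<m. (\<alpha> + real (Suc l + j)) - real i) / (y - real i))"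
    unfolding alt_binom_sum_def by (rule sum.cong) (use eq in auto)
  also have "\<dots> = (\<Prod>j<m. (\<alpha> + real (Suc l + j)) - y) * ((-1) ^ m * fact m / (\<Prod>j\<le>m. y - real j))"
    by (subst alt_binom_sum_prod_divide[OF order_refl y]; (subst alt_binom_sum_inverse[OF y])?; simp)
  also have "\<dots> \<noteq> 0"
  proof -
    have "\<alpha> + real (Suc l + j) - y \<noteq> 0" if "j < m" for j
    proof -
      have "real (Suc l + j) \<le> real (l + m)" using that by (simp only: of_nat_le_iff)
      then show ?thesis using assms by (simp add: y_def)
    qed
    then show ?thesis using y by (auto simp: prod_zero_iff)
  qed
  finally have "alt_binom_sum m (\<lambda>i. (\<Prod>j<m. (\<alpha> + real (Suc l + j)) - real i)
        * (pochhammer \<beta> (l + m - i) / pochhammer \<beta> (l + m + 1 - i))) \<noteq> 0" .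
  moreover have "pochhammer \<alpha> (Suc l) / (pochhammer \<beta> l * fact m) \<noteq> 0"
    using pochhammer_pos[of \<alpha> "Suc l"] pochhammer_pos[of \<beta> l] assms b by auto
  moreover have "l + m + 1 - Suc l = m" by simp
  ultimately show ?thesis
    using pade_prod_eq_alt_binom_sum[OF assms(1) b assms(3), of "l + m + 1"] by (simp del: of_nat_add)
qed

text \<open>Replacing each numerator by \<open>Q l * F - T l\<close>, with tail \<open>T l\<close>,
  cancels \<open>F\<close> and leaves \<open>Q (Suc l) * T l - Q l * T (Suc l)\<close>. Its terms
  start at degree \<open>l + m + 1\<close>, where only the first product contributes, and the degree
  of the polynomial is at most that.\<close>

lemma pade_cross_eq_monom:
  assumes "\<alpha> > 0" "\<beta> > \<alpha>" "m \<le> Suc l"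
  obtains c where "c \<noteq> 0"
    "pade_den \<alpha> \<beta> l m * pade_num \<alpha> \<beta> (Suc l) m - pade_den \<alpha> \<beta> (Suc l) m * pade_num \<alpha> \<beta> l m
       = monom c (l + m + 1)"
proof -
  have b: "\<beta> > 0" using assms by simp
  define N where "N = l + m + 1"
  define T where "T l = Abs_fps (\<lambda>k. if k \<le> l + m then 0 else pade_prod \<alpha> \<beta> l m k)" for l
  define F where "F = Abs_fps (poch_ratio \<alpha> \<beta>)"
  define Q where "Q l = fps_of_poly (pade_den \<alpha> \<beta> l m)" for l
  have P: "fps_of_poly (pade_num \<alpha> \<beta> l' m) = Q l' * F - T l'" if "m \<le> Suc l'" for l'
  proof (rule fps_ext)
    fix k
    have "fps_nth (Q l' * F) k = pade_prod \<alpha> \<beta> l' m k"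
      by (simp add: fps_mult_nth Q_def F_def coeff_pade_den pade_prod_def atMost_atLeast0)
    then show "fps_nth (fps_of_poly (pade_num \<alpha> \<beta> l' m)) k = fps_nth (Q l' * F - T l') k"
      using pade_prod_eq_0[OF assms(1) b that, of k] by (auto simp: coeff_pade_num T_def)
  qed
  define D where "D = pade_den \<alpha> \<beta> l m * pade_num \<alpha> \<beta> (Suc l) m - pade_den \<alpha> \<beta> (Suc l) m * pade_num \<alpha> \<beta> l m"
  have "fps_of_poly D = Q l * (Q (Suc l) * F - T (Suc l)) - Q (Suc l) * (Q l * F - T l)"
    using P[of l] P[of "Suc l"] assms by (simp add: D_def fps_of_poly_diff fps_of_poly_mult Q_def)
  also have "\<dots> = Q (Suc l) * T l - Q l * T (Suc l)" by (simp add: algebra_simps)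
  finally have D: "fps_of_poly D = Q (Suc l) * T l - Q l * T (Suc l)" .
  define c where "c = pade_coeff \<alpha> \<beta> (Suc l) m 0 * pade_prod \<alpha> \<beta> l m N"
  have "coeff D n = (if n = N then c else 0)" for n
  proof (cases "n \<le> N")
    case True
    have "(\<Sum>i=0..n. fps_nth (Q (Suc l)) i * fps_nth (T l) (n - i)) = (\<Sum>i=0..n. if i = 0 then (if n = N then c else 0) else 0)"
      by (rule sum.cong) (use True in \<open>auto simp: T_def N_def Q_def coeff_pade_den c_def\<close>)
    also have "\<dots> = (if n = N then c else 0)" by simp
    finally have 1: "fps_nth (Q (Suc l) * T l) n = (if n = N then c else 0)" by (simp add: fps_mult_nth)
    have "fps_nth (Q l * T (Suc l)) n = 0"
      unfolding fps_mult_nth by (rule sum.neutral) (use True in \<open>auto simp: T_def N_def\<close>)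
    with 1 show ?thesis using D by (metis diff_zero fps_of_poly_nth fps_sub_nth)
  next
    case False
    have "degree D \<le> N" unfolding D_def N_def
      by (rule degree_diff_le; rule order_trans[OF degree_mult_le])
         (use degree_pade_den[of \<alpha> \<beta> l m] degree_pade_den[of \<alpha> \<beta> "Suc l" m]
              degree_pade_num[of \<alpha> \<beta> l m] degree_pade_num[of \<alpha> \<beta> "Suc l" m] in linarith)+
    then show ?thesis using False by (simp add: coeff_eq_0)
  qed
  then have "D = monom c N" by (intro poly_eqI) (auto simp: coeff_monom)
  moreover have "c \<noteq> 0"
  proof -
    have "pade_coeff \<alpha> \<beta> (Suc l) m 0 \<noteq> 0"
      using pochhammer_pos[of "\<beta> + real (Suc l)" m] b by (simp add: pade_coeff_def del: of_nat_Suc)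
    then show ?thesis using pade_prod_neq_0[OF assms] by (simp add: c_def N_def)
  qed
  ultimately show ?thesis using that unfolding D_def N_def by blast
qed

section \<open>Size of the approximants and of the remainder\<close>

lemma poch_ratio_bounds:
  assumes "\<alpha> > 0" "\<beta> > \<alpha>"
  shows "0 \<le> poch_ratio \<alpha> \<beta> n" "poch_ratio \<alpha> \<beta> n \<le> 1"
proof -
  show "0 \<le> poch_ratio \<alpha> \<beta> n"
    using assms pochhammer_pos[of \<alpha> n] pochhammer_pos[of \<beta> n] by (simp add: poch_ratio_def)
  have "pochhammer \<alpha> n \<le> pochhammer \<beta> n"
    unfolding pochhammer_prod by (rule prod_mono) (use assms in auto)
  then show "poch_ratio \<alpha> \<beta> n \<le> 1"
    using assms pochhammer_pos[of \<beta> n] by (simp add: poch_ratio_def)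
qed

lemma abs_pade_prod_le:
  assumes "\<alpha> > 0" "\<beta> > \<alpha>" "m \<le> k"
  shows "\<bar>pade_prod \<alpha> \<beta> l m k\<bar> \<le> pade_height \<alpha> \<beta> l m"
proof -
  have "\<bar>pade_prod \<alpha> \<beta> l m k\<bar> \<le> (\<Sum>i\<le>m. \<bar>pade_coeff \<alpha> \<beta> l m i * poch_ratio \<alpha> \<beta> (k - i)\<bar>)"
    unfolding pade_prod_eq_sum[OF assms(3)] by (rule sum_abs)
  also have "\<dots> \<le> (\<Sum>i\<le>m. \<bar>pade_coeff \<alpha> \<beta> l m i\<bar>)"
    using poch_ratio_bounds[OF assms(1,2)] by (intro sum_mono) (simp add: abs_mult mult_left_le)
  finally show ?thesis by (simp add: pade_height_def)
qed

lemma abs_poly_pade_den_le: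
  assumes "\<bar>z\<bar> \<le> 1"
  shows "\<bar>poly (pade_den \<alpha> \<beta> l m) z\<bar> \<le> pade_height \<alpha> \<beta> l m"
proof -
  have "\<bar>poly (pade_den \<alpha> \<beta> l m) z\<bar> \<le> (\<Sum>i\<le>m. \<bar>pade_coeff \<alpha> \<beta> l m i * z ^ i\<bar>)"
    unfolding pade_den_def poly_sum poly_monom by (rule sum_abs)
  also have "\<dots> \<le> pade_height \<alpha> \<beta> l m" unfolding pade_height_def
    by (intro sum_mono) (simp add: abs_mult power_abs mult_left_le power_le_one assms)
  finally show ?thesis .
qed

text \<open>In the Cauchy product the terms up to \<open>l\<close> form the numerator and the next
  \<open>m\<close> vanish. The rest is dominated by a geometric series, whose sum costs a factor 2
  for \<open>\<bar>z\<bar> \<le> 1/2\<close>.\<close>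

lemma pade_remainder_le:
  assumes ab: "\<alpha> > 0" "\<beta> > \<alpha>" and ml: "m \<le> Suc l" and z: "\<bar>z\<bar> \<le> 1/2"
  shows "\<bar>poly (pade_den \<alpha> \<beta> l m) z * phi (\<beta> - \<alpha>) \<alpha> z - poly (pade_num \<alpha> \<beta> l m) z\<bar>
     \<le> 2 * pade_height \<alpha> \<beta> l m * \<bar>z\<bar> ^ (l + m + 1)"
proof -
  let ?q = "pade_coeff \<alpha> \<beta> l m" and ?w = "poch_ratio \<alpha> \<beta>" and ?R = "pade_prod \<alpha> \<beta> l m"
  let ?S = "pade_height \<alpha> \<beta> l m"
  have geo: "summable (\<lambda>n. \<bar>z\<bar> ^ n)" using z by (intro summable_geometric) simp
  have sw: "summable (\<lambda>n. norm (?w n * z ^ n))"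
  proof (rule summable_comparison_test'[OF geo, of 0])
    fix n
    show "norm (norm (?w n * z ^ n)) \<le> \<bar>z\<bar> ^ n"
      using poch_ratio_bounds[OF ab, of n] by (simp add: abs_mult power_abs mult_left_le_one_le)
  qed
  have fz: "?q i * z ^ i = 0" if "i \<notin> {..m}" for i using that by (simp add: pade_coeff_def)
  have sq: "summable (\<lambda>i. norm (?q i * z ^ i))"
    by (rule summable_finite[of "{..m}"]) (use fz in auto)
  have qeq: "(\<Sum>i. ?q i * z ^ i) = poly (pade_den \<alpha> \<beta> l m) z"
    using suminf_finite[of "{..m}" "\<lambda>i. ?q i * z ^ i"] fz
    by (simp add: pade_den_def poly_sum poly_monom)
  have weq: "(\<Sum>n. ?w n * z ^ n) = phi (\<beta> - \<alpha>) \<alpha> z" by (simp add: phi_def poch_ratio_def)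
  have "(\<lambda>k. \<Sum>i\<le>k. (?q i * z ^ i) * (?w (k - i) * z ^ (k - i))) sums
      (poly (pade_den \<alpha> \<beta> l m) z * phi (\<beta> - \<alpha>) \<alpha> z)"
    using Cauchy_product_sums[OF sq sw] unfolding qeq weq .
  moreover have "(\<Sum>i\<le>k. (?q i * z ^ i) * (?w (k - i) * z ^ (k - i))) = ?R k * z ^ k" for k
    unfolding pade_prod_def sum_distrib_right
  proof (rule sum.cong[OF refl])
    fix i assume "i \<in> {..k}"
    then have "z ^ k = z ^ i * z ^ (k - i)" by (simp flip: power_add)
    then show "?q i * z ^ i * (?w (k - i) * z ^ (k - i)) = ?q i * ?w (k - i) * z ^ k" by simp
  qed
  ultimately have sums: "(\<lambda>k. ?R k * z ^ k) sums (poly (pade_den \<alpha> \<beta> l m) z * phi (\<beta> - \<alpha>) \<alpha> z)"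
    by simp
  let ?N = "l + m + 1"
  have "(\<Sum>k<?N. ?R k * z ^ k) = (\<Sum>k\<le>l. ?R k * z ^ k)"
    by (rule sum.mono_neutral_right) (use pade_prod_eq_0[of \<alpha> \<beta> m l] ab ml in auto)
  also have "\<dots> = poly (pade_num \<alpha> \<beta> l m) z" by (simp add: pade_num_def poly_sum poly_monom)
  finally have "(\<lambda>k. ?R (k + ?N) * z ^ (k + ?N)) sums
     (poly (pade_den \<alpha> \<beta> l m) z * phi (\<beta> - \<alpha>) \<alpha> z - poly (pade_num \<alpha> \<beta> l m) z)"
    using sums_iff_shift[of "\<lambda>k. ?R k * z ^ k" ?N] sums by (simp add: algebra_simps)
  moreover have "(\<lambda>k. ?S * \<bar>z\<bar> ^ ?N * \<bar>z\<bar> ^ k) sums (?S * \<bar>z\<bar> ^ ?N * (1 / (1 - \<bar>z\<bar>)))"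
    using z by (intro sums_mult geometric_sums) simp
  moreover have "norm (?R (k + ?N) * z ^ (k + ?N)) \<le> ?S * \<bar>z\<bar> ^ ?N * \<bar>z\<bar> ^ k" for k
    using mult_right_mono[OF abs_pade_prod_le[OF ab, of m "k + ?N" l], of "\<bar>z\<bar> ^ (k + ?N)"]
    by (simp add: abs_mult power_abs power_add mult_ac)
  ultimately have "\<bar>poly (pade_den \<alpha> \<beta> l m) z * phi (\<beta> - \<alpha>) \<alpha> z - poly (pade_num \<alpha> \<beta> l m) z\<bar>
     \<le> ?S * \<bar>z\<bar> ^ ?N * (1 / (1 - \<bar>z\<bar>))"
    unfolding real_norm_def[symmetric] by (rule norm_sums_le)
  also have "\<dots> \<le> ?S * \<bar>z\<bar> ^ ?N * 2"
    using z by (intro mult_left_mono) (auto simp: field_simps pade_height_def intro!: sum_nonneg)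
  finally show ?thesis by (simp add: mult_ac)
qed

section \<open>Arithmetic of the approximants\<close>

text \<open>Inserting \<open>fact j\<close> splits the product into four quotients, made integral by
  \<open>v ^ (2 * (m - i))\<close>, \<open>s ^ (2 * i)\<close>, \<open>s ^ (2 * j)\<close> and the
  least common multiple. Since \<open>i + j \<le> l\<close>, the powers available suffice.\<close>

lemma pade_coeff_mult_poch_ratio_in_Ints:
  fixes r s u v l m i j :: nat
  assumes pos: "r > 0" "s > 0" "u > 0" "v > 0" and ij: "i \<le> m" "i + j \<le> l"
  shows "real (s ^ (2 * l) * v ^ (2 * m) * Lcm {1..u + l * v})
     * (pade_coeff (real r / real s) (real u / real v) l m i * poch_ratio (real r / real s) (real u / real v) j) \<in> \<int>"
proof -
  define \<alpha> \<beta> where "\<alpha> = real r / real s" and "\<beta> = real u / real v"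
  define X where "X = real v ^ (2 * (m - i)) * (pochhammer (\<beta> + real l) (m - i) / fact (m - i))"
  define Y where "Y = real s ^ (2 * i) * (pochhammer (\<alpha> + real l + 1 - real i) i / fact i)"
  define Z where "Z = real s ^ (2 * j) * (pochhammer \<alpha> j / fact j)"
  define W where "W = real (Lcm {1..u + l * v}) * (fact j / pochhammer \<beta> j)"
  have "\<beta> + real l = real (u + l * v) / real v" using pos by (simp add: \<beta>_def field_simps)
  then have X: "X \<in> \<int>" unfolding X_def using pos
    by (simp only:) (rule pochhammer_over_fact_in_Ints, auto)
  have "\<alpha> + real l + 1 - real i = real (r + (l + 1 - i) * s) / real s"
    using pos ij by (simp add: \<alpha>_def field_simps of_nat_diff)
  then have Y: "Y \<in> \<int>" unfolding Y_def using pos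
    by (simp only:) (rule pochhammer_over_fact_in_Ints, auto)
  have Z: "Z \<in> \<int>" unfolding Z_def \<alpha>_def using pos by (intro pochhammer_over_fact_in_Ints) auto
  have W: "W \<in> \<int>" unfolding W_def \<beta>_def using pos ij
    by (intro Lcm_fact_over_pochhammer_in_Ints) auto
  have "real s ^ (2 * l) = real s ^ (2 * (l - i - j)) * real s ^ (2 * i) * real s ^ (2 * j)"
    unfolding power_add[symmetric] by (rule arg_cong[where f = "\<lambda>n. real s ^ n"]) (use ij in auto)
  moreover have "real v ^ (2 * m) = real v ^ (2 * i) * real v ^ (2 * (m - i))"
    unfolding power_add[symmetric] by (rule arg_cong[where f = "\<lambda>n. real v ^ n"]) (use ij in auto)
  ultimately have "real (s ^ (2 * l) * v ^ (2 * m) * Lcm {1..u + l * v})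
       * (pade_coeff \<alpha> \<beta> l m i * poch_ratio \<alpha> \<beta> j)
     = (-1) ^ i * real s ^ (2 * (l - i - j)) * real v ^ (2 * i) * X * Y * Z * W"
    using ij by (simp add: pade_coeff_def poch_ratio_def X_def Y_def Z_def W_def)
  also have "\<dots> \<in> \<int>" using X Y Z W by (intro Ints_mult Ints_power) auto
  finally show ?thesis by (simp only: \<alpha>_def \<beta>_def)
qed

text \<open>Raising \<open>\<alpha>\<close> and \<open>\<beta>\<close> to the integers
  \<open>r\<close> and \<open>u\<close> turns the two quotients into binomial coefficients. The
  first is bounded by a power of 2, the second is summed along its row.\<close>

lemma pade_height_le:
  fixes r u :: nat
  assumes a: "0 < \<alpha>" "\<alpha> \<le> real r" and b: "0 < \<beta>" "\<beta> \<le> real u" and ml: "m \<le> l"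
  shows "pade_height \<alpha> \<beta> l m \<le> 2 ^ (u + r + 2 * l + m)"
proof -
  have u: "u > 0" using b by (cases u) auto
  have A: "0 \<le> pochhammer (\<beta> + real l) k / fact k" "pochhammer (\<beta> + real l) k / fact k \<le> 2 ^ (u + l + m)"
    if "k \<le> m" for k
  proof -
    show "0 \<le> pochhammer (\<beta> + real l) k / fact k" using b by (simp add: pochhammer_nonneg)
    have "pochhammer (\<beta> + real l) k \<le> pochhammer (real (u + l + k - 1) - real k + 1) k"
      unfolding pochhammer_prod using b u by (intro prod_mono) (auto simp: of_nat_diff)
    then have "pochhammer (\<beta> + real l) k / fact k \<le> real (u + l + k - 1) gchoose k"
      unfolding gbinomial_pochhammer' by (rule divide_right_mono) simp
    also have "\<dots> = real ((u + l + k - 1) choose k)" by (simp add: binomial_gbinomial)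
    also have "\<dots> \<le> real (2 ^ (u + l + k - 1))" by (simp only: of_nat_le_iff binomial_le_pow2)
    also have "\<dots> \<le> 2 ^ (u + l + m)" using that by (simp add: power_increasing)
    finally show "pochhammer (\<beta> + real l) k / fact k \<le> 2 ^ (u + l + m)" .
  qed
  have B: "0 \<le> pochhammer (\<alpha> + real l + 1 - real i) i / fact i"
      "pochhammer (\<alpha> + real l + 1 - real i) i / fact i \<le> real ((r + l) choose i)" if "i \<le> m" for i
  proof -
    have p: "\<alpha> + real l + 1 - real i > 0" using a that ml by simp
    then show "0 \<le> pochhammer (\<alpha> + real l + 1 - real i) i / fact i" by (simp add: pochhammer_nonneg)
    have "pochhammer (\<alpha> + real l + 1 - real i) i \<le> pochhammer (real (r + l) - real i + 1) i"
      unfolding pochhammer_prod using a p by (intro prod_mono) auto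
    then have "pochhammer (\<alpha> + real l + 1 - real i) i / fact i \<le> real (r + l) gchoose i"
      unfolding gbinomial_pochhammer' by (rule divide_right_mono) simp
    then show "pochhammer (\<alpha> + real l + 1 - real i) i / fact i \<le> real ((r + l) choose i)"
      by (simp only: binomial_gbinomial)
  qed
  have "pade_height \<alpha> \<beta> l m \<le> (\<Sum>i\<le>m. 2 ^ (u + l + m) * real ((r + l) choose i))"
    unfolding pade_height_def
  proof (rule sum_mono)
    fix i assume "i \<in> {..m}"
    then have i: "i \<le> m" "m - i \<le> m" by auto
    have "\<bar>pade_coeff \<alpha> \<beta> l m i\<bar> = (pochhammer (\<beta> + real l) (m - i) / fact (m - i))
            * (pochhammer (\<alpha> + real l + 1 - real i) i / fact i)"
    proof -
      have "\<bar>(-1) ^ i * x * y\<bar> = x * y" if "x \<ge> 0" "y \<ge> 0" for x y :: real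
        using that by (simp add: abs_mult)
      from this[OF A(1)[OF i(2)] B(1)[OF i(1)]] show ?thesis
        using i(1) by (simp only: pade_coeff_def if_True)
    qed
    also have "\<dots> \<le> 2 ^ (u + l + m) * real ((r + l) choose i)"
      by (intro mult_mono A B i) auto
    finally show "\<bar>pade_coeff \<alpha> \<beta> l m i\<bar> \<le> 2 ^ (u + l + m) * real ((r + l) choose i)" .
  qed
  also have "\<dots> = 2 ^ (u + l + m) * (\<Sum>i\<le>m. real ((r + l) choose i))" by (simp add: sum_distrib_left)
  also have "(\<Sum>i\<le>m. real ((r + l) choose i)) \<le> (\<Sum>i\<le>r + l. real ((r + l) choose i))"
    using ml by (intro sum_mono2) auto
  also have "\<dots> = 2 ^ (r + l)" by (simp only: of_nat_sum[symmetric] choose_row_sum) simp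
  also have "2 ^ (u + l + m) * (2::real) ^ (r + l) = 2 ^ (u + r + 2 * l + m)"
    unfolding power_add[symmetric] by (rule arg_cong[where f = "\<lambda>n. 2 ^ n"]) simp
  finally show ?thesis by simp
qed

lemma poly_fraction_in_Ints:
  fixes p :: "real poly" and a b :: int
  assumes D: "\<And>i. D * coeff p i \<in> \<int>" and deg: "degree p \<le> n" and b: "b \<noteq> 0"
  shows "D * real_of_int b ^ n * poly p (real_of_int a / real_of_int b) \<in> \<int>"
proof -
  have "D * real_of_int b ^ n * poly p (real_of_int a / real_of_int b)
     = (\<Sum>i\<le>degree p. D * coeff p i * of_int a ^ i * of_int b ^ (n - i))"
    unfolding poly_altdef sum_distrib_left
  proof (rule sum.cong[OF refl])
    fix i assume "i \<in> {..degree p}"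
    then have "real_of_int b ^ n = of_int b ^ i * of_int b ^ (n - i)"
      using deg by (simp flip: power_add)
    then show "D * real_of_int b ^ n * (coeff p i * (real_of_int a / real_of_int b) ^ i)
       = D * coeff p i * of_int a ^ i * of_int b ^ (n - i)"
      using b by (simp add: power_divide)
  qed
  also have "\<dots> \<in> \<int>" by (intro Ints_sum Ints_mult D Ints_power Ints_of_int)
  finally show ?thesis .
qed

text \<open>Here \<open>P - Q * y\<close> is the sum of \<open>P - Q * f\<close> and
  \<open>Q * (f - y)\<close>. Times \<open>K\<close> it is a nonzero integer, and
  \<open>small\<close> keeps the share of the remainder to at most 1/2; so
  \<open>Q * (f - y)\<close> carries the other half, while
  \<open>\<bar>Q\<bar> \<le> S\<close>.\<close>

lemma pade_lower_bound:
  fixes a b B n :: int and M :: nat and D :: real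
  assumes ab: "\<alpha> > 0" "\<beta> > \<alpha>" and b: "b \<ge> 1" and B: "B \<ge> 1" and l: "M + m \<le> l"
    and z: "z = real_of_int a / real_of_int b" "\<bar>z\<bar> \<le> 1/2"
    and y: "y = real_of_int n / (real_of_int B * real_of_int b ^ M)"
    and D: "D \<ge> 1" "\<And>i. D * coeff (pade_den \<alpha> \<beta> l m) i \<in> \<int>" "\<And>i. D * coeff (pade_num \<alpha> \<beta> l m) i \<in> \<int>"
    and S: "pade_height \<alpha> \<beta> l m \<le> S" "S > 0"
    and small: "4 * D * S * real_of_int B * real_of_int b ^ l * \<bar>z\<bar> ^ (l + m + 1) \<le> 1"
    and neq: "poly (pade_num \<alpha> \<beta> l m) z \<noteq> poly (pade_den \<alpha> \<beta> l m) z * y"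
  shows "1 / (2 * D * S * real_of_int B * real_of_int b ^ l) \<le> \<bar>phi (\<beta> - \<alpha>) \<alpha> z - y\<bar>"
proof -
  define P Q f where "P = poly (pade_num \<alpha> \<beta> l m) z" and "Q = poly (pade_den \<alpha> \<beta> l m) z"
    and "f = phi (\<beta> - \<alpha>) \<alpha> z"
  define K where "K = D * real_of_int B * real_of_int b ^ l"
  have K: "K > 0" using D b B by (simp add: K_def)
  have bl: "real_of_int b ^ l = real_of_int b ^ M * real_of_int b ^ (l - M)"
    using l by (simp flip: power_add)
  \<comment> \<open>The denominator of \<open>y\<close> uses up \<open>b ^ M\<close>; the remaining
    \<open>b ^ (l - M)\<close> still clears \<open>Q\<close>, whose degree is at most
    \<open>m \<le> l - M\<close>.\<close>
  have "K * (P - Q * y) = of_int B * (D * real_of_int b ^ l * P) - of_int n * (D * real_of_int b ^ (l - M) * Q)"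
    using b B by (simp add: K_def y bl field_simps)
  also have "\<dots> \<in> \<int>"
  proof -
    have "D * real_of_int b ^ l * P \<in> \<int>" unfolding P_def z(1)
      by (rule poly_fraction_in_Ints) (use D b degree_pade_num in auto)
    moreover have "degree (pade_den \<alpha> \<beta> l m) \<le> l - M"
      using degree_pade_den[of \<alpha> \<beta> l m] l by linarith
    then have "D * real_of_int b ^ (l - M) * Q \<in> \<int>" unfolding Q_def z(1)
      by (intro poly_fraction_in_Ints) (use D b in auto)
    ultimately show ?thesis by (intro Ints_diff Ints_mult[OF Ints_of_int])
  qed
  finally have int: "K * (P - Q * y) \<in> \<int>" .
  have "K * (P - Q * y) \<noteq> 0" using K neq by (simp add: P_def Q_def)
  then have "1 \<le> \<bar>K * (P - Q * y)\<bar>" using Ints_nonzero_abs_ge1[OF int] by simp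
  then have 1: "1 \<le> K * \<bar>P - Q * y\<bar>" using K by (simp add: abs_mult)
  have "\<bar>Q * f - P\<bar> \<le> 2 * pade_height \<alpha> \<beta> l m * \<bar>z\<bar> ^ (l + m + 1)"
    unfolding Q_def P_def f_def by (rule pade_remainder_le) (use ab l z in auto)
  also have "\<dots> \<le> 2 * S * \<bar>z\<bar> ^ (l + m + 1)" using S by (intro mult_right_mono) auto
  finally have "K * \<bar>Q * f - P\<bar> \<le> K * (2 * S * \<bar>z\<bar> ^ (l + m + 1))" using K by simp
  moreover have "2 * (K * (2 * S * \<bar>z\<bar> ^ (l + m + 1))) \<le> 1"
    using small by (simp add: K_def mult_ac)
  ultimately have 2: "2 * (K * \<bar>Q * f - P\<bar>) \<le> 1" by linarith
  have "\<bar>P - Q * y\<bar> \<le> \<bar>Q * f - P\<bar> + \<bar>Q * (f - y)\<bar>" by (simp add: algebra_simps)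
  then have "K * \<bar>P - Q * y\<bar> \<le> K * \<bar>Q * f - P\<bar> + K * \<bar>Q * (f - y)\<bar>"
    using K by (simp flip: distrib_left)
  then have 3: "1 \<le> 2 * (K * \<bar>Q * (f - y)\<bar>)" using 1 2 by linarith
  have "\<bar>Q\<bar> \<le> S" unfolding Q_def using abs_poly_pade_den_le[of z \<alpha> \<beta> l m] z S by linarith
  then have "\<bar>Q * (f - y)\<bar> \<le> S * \<bar>f - y\<bar>" by (simp add: abs_mult mult_right_mono)
  then have "K * \<bar>Q * (f - y)\<bar> \<le> K * (S * \<bar>f - y\<bar>)" using K by simp
  then have "1 \<le> 2 * K * S * \<bar>f - y\<bar>" using 3 by (simp add: mult_ac)
  then have "1 / (2 * K * S) \<le> \<bar>f - y\<bar>" using K S by (simp add: field_simps)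
  then show ?thesis by (simp add: K_def f_def mult_ac)
qed

text \<open>If both equalities held, the cross product would vanish at \<open>z\<close>, but it is a
  nonzero monomial and \<open>z \<noteq> 0\<close>.\<close>

lemma pade_nonvanishing:
  assumes "\<alpha> > 0" "\<beta> > \<alpha>" "m \<le> Suc l" "z \<noteq> 0"
  obtains l' where "l' \<in> {l, Suc l}" "poly (pade_num \<alpha> \<beta> l' m) z \<noteq> poly (pade_den \<alpha> \<beta> l' m) z * y"
proof -
  obtain c where c: "c \<noteq> 0"
    "pade_den \<alpha> \<beta> l m * pade_num \<alpha> \<beta> (Suc l) m - pade_den \<alpha> \<beta> (Suc l) m * pade_num \<alpha> \<beta> l m
       = monom c (l + m + 1)"
    using pade_cross_eq_monom[OF assms(1-3)] by blast
  have "poly (pade_den \<alpha> \<beta> l m) z * poly (pade_num \<alpha> \<beta> (Suc l) m) z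
      - poly (pade_den \<alpha> \<beta> (Suc l) m) z * poly (pade_num \<alpha> \<beta> l m) z = c * z ^ (l + m + 1)"
    unfolding poly_mult[symmetric] poly_diff[symmetric] c(2) by (simp add: poly_monom)
  then have "\<not> (\<forall>l'\<in>{l, Suc l}. poly (pade_num \<alpha> \<beta> l' m) z = poly (pade_den \<alpha> \<beta> l' m) z * y)"
    using c(1) assms(4) by auto
  then show ?thesis using that by blast
qed

section \<open>The lower bound\<close>

lemma eps_ge_1: "eps n \<ge> 1"
  unfolding eps_def
proof (rule prod_ge_1)
  fix p assume "p \<in> prime_factors n"
  then have "p \<ge> 2" by (intro prime_ge_2_nat) auto
  then show "1 \<le> real p powr (1 / (real p - 1))" by (intro ge_one_powr_ge_zero) auto
qed

text \<open>The quadratic Taylor bound gives \<open>x \<le> exp (x / 2)\<close>. It serves to absorb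
  the powers of \<open>s\<close> and \<open>v\<close> into exponentials.\<close>

lemma square_le_exp:
  fixes x :: real
  assumes "x \<ge> 0"
  shows "x ^ 2 \<le> exp x"
proof -
  have "1 + x / 2 + (x / 2) ^ 2 / 2 \<le> exp (x / 2)"
    using exp_lower_Taylor_quadratic[of "x / 2"] assms by simp
  moreover have "x \<le> 1 + x / 2 + (x / 2) ^ 2 / 2"
    using zero_le_power2[of "x - 2"] by (simp add: power2_eq_square algebra_simps)
  ultimately have "x ^ 2 \<le> exp (x / 2) ^ 2" using assms by (intro power_mono) auto
  also have "exp (x / 2) ^ 2 = exp x" by (simp flip: exp_double)
  finally show ?thesis .
qed

lemma pade_denominator_height_le:
  fixes r s u v l m :: nat and th Lam :: real
  assumes s: "s > 0" and v: "v > 0" and th: "th \<ge> 1" and ml: "m \<le> l"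
    and Lam: "Lam \<ge> 0" "Lam \<le> exp (th * real (u + l * v))"
  shows "(real s ^ (2 * l) * real v ^ (2 * m) * Lam) * 2 ^ (u + r + 2 * l + m)
    \<le> exp (th * (real r + 2 * real u)) * exp (th * (1/2 + real s + 2 * real v)) ^ (2 * l)"
proof -
  have "real s ^ (2 * l) \<le> exp (real s) ^ l"
    unfolding power_mult by (intro power_mono square_le_exp) auto
  then have s': "real s ^ (2 * l) \<le> exp (real l * real s)" by (simp add: exp_of_nat_mult)
  have "real v ^ (2 * m) \<le> real v ^ (2 * l)" using v ml by (intro power_increasing) auto
  also have "\<dots> \<le> exp (real v) ^ l"
    unfolding power_mult by (intro power_mono square_le_exp) auto
  finally have v': "real v ^ (2 * m) \<le> exp (real l * real v)" by (simp add: exp_of_nat_mult)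
  have "(2::real) ^ (u + r + 2 * l + m) \<le> exp 1 ^ (u + r + 2 * l + m)"
    using exp_ge_add_one_self[of "1::real"] by (intro power_mono) auto
  also have "\<dots> \<le> exp 1 ^ (u + r + 3 * l)" using ml by (intro power_increasing) auto
  also have "\<dots> = exp (real (u + r + 3 * l))" by (simp only: exp_of_nat_mult[symmetric] mult_1_right)
  finally have two: "(2::real) ^ (u + r + 2 * l + m) \<le> exp (real (u + r + 3 * l))" .
  have "(real s ^ (2 * l) * real v ^ (2 * m) * Lam) * 2 ^ (u + r + 2 * l + m)
     \<le> (exp (real l * real s) * exp (real l * real v) * exp (th * real (u + l * v))) * exp (real (u + r + 3 * l))"
    using Lam s' v' two by (intro mult_mono) auto
  also have "\<dots> = exp (real l * real s + real l * real v + th * real (u + l * v) + real (u + r + 3 * l))"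
    by (simp only: exp_add)
  also have "\<dots> \<le> exp (th * (real r + 2 * real u) + real (2 * l) * (th * (1/2 + real s + 2 * real v)))"
  proof -
    \<comment> \<open>Exponents per unit of \<open>l\<close>: of the available
      \<open>th * (1 + 2 * s + 4 * v)\<close> the least common multiple takes \<open>th * v\<close>,
      which leaves this for \<open>s\<close>, \<open>v\<close> and the powers of 2.\<close>
    have 1: "real s + real v + 3 \<le> th * (1 + 2 * real s + 3 * real v)"
    proof -
      have "real s + real v + 3 \<le> 1 * (1 + 2 * real s + 3 * real v)"
        using s v by (simp flip: of_nat_add of_nat_mult)
      also have "\<dots> \<le> th * (1 + 2 * real s + 3 * real v)" using th by (intro mult_right_mono) auto
      finally show ?thesis .
    qed
    have 2: "real (u + r) \<le> th * real (u + r)" using mult_right_mono[OF th, of "real (u + r)"] by simp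
    have "real l * (real s + real v + 3) \<le> real l * (th * (1 + 2 * real s + 3 * real v))"
      using 1 by (rule mult_left_mono) simp
    with 2 show ?thesis by (simp add: algebra_simps)
  qed
  also have "\<dots> = exp (th * (real r + 2 * real u)) * exp (th * (1/2 + real s + 2 * real v)) ^ (2 * l)"
    by (simp only: exp_add exp_of_nat_mult)
  finally show ?thesis .
qed

text \<open>The number \<open>X\<close> is \<open>M\<close> measured in units of
  \<open>ln b / ln A\<close>, so that the condition on \<open>M\<close> becomes a list of lower
  bounds for \<open>X\<close>. All size estimates are then comparisons of logarithms, based on
  \<open>ln A \<le> ln b / 6\<close>.\<close>

lemma phi_fraction_lower_bound:
  fixes r s u v :: nat and a b B n :: int and M :: nat and th a1 a2 X :: real
  defines "A \<equiv> a1 * \<bar>real_of_int a\<bar>"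
  assumes pos: "r > 0" "s > 0" "u > 0" "v > 0" and lt: "real r / real s < real u / real v"
    and th: "th > 1" and cth: "\<forall>x\<ge>cth. real (prime_pi x) \<le> th * x / ln x"
    and a: "a \<noteq> 0" and b: "b \<ge> 1" and B: "B \<ge> 1"
    and a1: "a1 \<ge> exp (th * (1/2 + real s + 2 * real v))"
    and a2: "a2 \<ge> 4 * exp (th * (real r + 2 * real u))"
    and bA: "real_of_int b \<ge> A ^ 6"
    and X: "real M * ln A = X * ln (real_of_int b)" "X \<ge> 5/2" "cth \<le> 2 * X - 1"
    and Xa2: "6 * ln (a2 * \<bar>real_of_int a\<bar>) \<le> (X - 1/2) * ln (real_of_int b)"
    and XB: "4 * ln (real_of_int B) \<le> (2 * X - 1) * ln (real_of_int b)"
  shows "\<bar>phi (real u / real v - real r / real s) (real r / real s) (real_of_int a / real_of_int b)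
             - real_of_int n / (real_of_int B * real_of_int b ^ M)\<bar>
          \<ge> 1 / (real_of_int B * real_of_int b ^ M * (a1 ^ 18 * \<bar>real_of_int a\<bar> ^ 17) ^ M)"
proof -
  define \<alpha> \<beta> where "\<alpha> = real r / real s" and "\<beta> = real u / real v"
  define z y where "z = real_of_int a / real_of_int b" and "y = real_of_int n / (real_of_int B * real_of_int b ^ M)"
  define la1 laa lb lB la2 where "la1 = ln a1" and "laa = ln \<bar>real_of_int a\<bar>"
    and "lb = ln (real_of_int b)" and "lB = ln (real_of_int B)" and "la2 = ln a2"
  define lA where "lA = la1 + laa"
  \<comment> \<open>Both \<open>4 * X < m + 1\<close> and \<open>m \<le> 4 * X\<close> matter: the
    first makes the remainder small, the second limits the final loss.\<close>
  define m where "m = nat \<lfloor>4 * X\<rfloor>"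
  have aa: "\<bar>real_of_int a\<bar> \<ge> 1" using a by linarith
  have bp: "real_of_int b > 0" and Bp: "real_of_int B > 0" using b B by auto
  have "exp 1 \<le> exp (th * (1/2 + real s + 2 * real v))"
  proof -
    have "1 * 1 \<le> th * (1/2 + real s + 2 * real v)"
      using th pos by (intro mult_mono) auto
    then show ?thesis by simp
  qed
  then have a1e: "exp 1 \<le> a1" using a1 by linarith
  then have a1p: "a1 > 0" using less_le_trans[OF exp_gt_zero] by blast
  have a2p: "a2 > 0" using a2 exp_gt_zero[of "th * (real r + 2 * real u)"] by linarith
  have la1: "la1 \<ge> 1" using a1e a1p unfolding la1_def by (simp add: ln_ge_iff)
  have laa: "laa \<ge> 0" using aa by (simp add: laa_def)
  have lnA: "ln A = lA" using a1p aa by (simp add: A_def lA_def la1_def laa_def ln_mult)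
  have Ap: "A > 0" using a1p aa by (simp add: A_def)
  have "6 * lA = ln (A ^ 6)" using Ap lnA by (simp add: ln_realpow)
  also have "\<dots> \<le> lb" unfolding lb_def using bA bp Ap by (subst ln_le_cancel_iff) auto
  finally have lb6: "6 * lA \<le> lb" .
  have lA1: "lA \<ge> 1" using la1 laa by (simp add: lA_def)
  have lbp: "lb > 0" using lb6 lA1 by linarith
  have MX: "real M * lA = X * lb" using X(1) by (simp add: lnA lb_def)
  have Xa2': "6 * (la2 + laa) \<le> (X - 1/2) * lb"
    using Xa2 a2p a by (simp add: la2_def laa_def lb_def ln_mult)
  have XB': "4 * lB \<le> (2 * X - 1) * lb" using XB by (simp add: lB_def lb_def)
  have m1: "4 * X < real m + 1" "real m \<le> 4 * X" using X(2) by (auto simp: m_def)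
  have "\<alpha> > 0" "\<beta> > \<alpha>" using pos lt by (auto simp: \<alpha>_def \<beta>_def)
  note ab = this
  have "X \<le> real M"
  proof (rule ccontr)
    assume "\<not> X \<le> real M"
    then have "real M * lA < X * lA" using lA1 by simp
    also have "\<dots> \<le> X * lb" using lb6 lA1 X(2) by (intro mult_left_mono) auto
    finally show False using MX by simp
  qed
  have z2: "\<bar>z\<bar> \<le> 1/2"
  proof -
    have "ln (2 * \<bar>real_of_int a\<bar>) = ln 2 + laa" using aa by (simp add: laa_def ln_mult)
    also have "\<dots> \<le> lb" using ln_le_minus_one[of "2::real"] lb6 la1 laa unfolding lA_def by simp
    finally have "2 * \<bar>real_of_int a\<bar> \<le> real_of_int b"
      unfolding lb_def using aa bp by (subst (asm) ln_le_cancel_iff) auto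
    then show ?thesis using bp by (simp add: z_def field_simps)
  qed
  have "z \<noteq> 0" using a bp by (simp add: z_def)
  then obtain l where l: "l \<in> {M + m, Suc (M + m)}"
      and neq: "poly (pade_num \<alpha> \<beta> l m) z \<noteq> poly (pade_den \<alpha> \<beta> l m) z * y"
    using pade_nonvanishing[OF ab, of m "M + m" z y] by auto
  have lM: "M + m \<le> l" "m \<le> l" "real l \<le> real M + real m + 1" using l by auto
  define D where "D = real (s ^ (2 * l) * v ^ (2 * m) * Lcm {1..u + l * v})"
  define S where "S = (2::real) ^ (u + r + 2 * l + m)"
  have S: "pade_height \<alpha> \<beta> l m \<le> S" "S > 0"
  proof -
    have "real r / real s \<le> real r" "real u / real v \<le> real u"
      using pos by (auto simp: field_simps mult_le_cancel_left1)
    then show "pade_height \<alpha> \<beta> l m \<le> S"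
      unfolding S_def using ab lM by (intro pade_height_le) (auto simp: \<alpha>_def \<beta>_def)
  qed (simp add: S_def)
  have L0: "Lcm {1..u + l * v} \<noteq> 0" by (auto simp: Lcm_0_iff_nat)
  have "s ^ (2 * l) * v ^ (2 * m) * Lcm {1..u + l * v} \<noteq> 0" using pos L0 by simp
  then have D1: "D \<ge> 1" unfolding D_def by linarith
  have Dint: "D * (pade_coeff \<alpha> \<beta> l m i * poch_ratio \<alpha> \<beta> j) \<in> \<int>" if "i + j \<le> l" for i j
  proof (cases "i \<le> m")
    case True
    then show ?thesis unfolding D_def \<alpha>_def \<beta>_def
      using pade_coeff_mult_poch_ratio_in_Ints[OF pos True that] by blast
  qed (simp add: pade_coeff_def)
  have Dden: "D * coeff (pade_den \<alpha> \<beta> l m) i \<in> \<int>" for i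
  proof (cases "i \<le> m")
    case True
    then show ?thesis using Dint[of i 0] lM by (simp add: coeff_pade_den poch_ratio_def)
  qed (simp add: coeff_pade_den pade_coeff_def)
  have Dnum: "D * coeff (pade_num \<alpha> \<beta> l m) k \<in> \<int>" for k
    unfolding coeff_pade_num pade_prod_def sum_distrib_left if_distrib
    by (auto intro!: Ints_sum Dint simp: sum_distrib_left)
  have DS: "4 * (D * S) \<le> a2 * a1 ^ (2 * l)"
  proof -
    \<comment> \<open>Since \<open>X \<le> M\<close>, the number \<open>u + l * v\<close> is at
      least \<open>M + m > 5 * X - 1\<close>, which exceeds both \<open>2 * X - 1 \<ge> cth\<close>
      and 2.\<close>
    have N2: "cth \<le> real (u + l * v)" "2 \<le> u + l * v"
    proof -
      have "real M + real m \<le> real l" using lM(1) by (simp flip: of_nat_add)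
      also have "\<dots> \<le> real (u + l * v)" using pos by (simp only: of_nat_le_iff) (simp add: trans_le_add2)
      finally have *: "real M + real m \<le> real (u + l * v)" .
      then show "cth \<le> real (u + l * v)" using X m1 \<open>X \<le> real M\<close> by linarith
      have "real 2 \<le> real (u + l * v)" using * X m1 \<open>X \<le> real M\<close> by linarith
      then show "2 \<le> u + l * v" by (simp only: of_nat_le_iff)
    qed
    have "real (Lcm {1..u + l * v}) \<le> exp (th * real (u + l * v))"
      using N2 cth by (intro Lcm_upto_le_exp) auto
    then have "D * S \<le> exp (th * (real r + 2 * real u)) * exp (th * (1/2 + real s + 2 * real v)) ^ (2 * l)"
      unfolding D_def S_def of_nat_mult of_nat_power
      using pos th lM by (intro pade_denominator_height_le) auto
    also have "\<dots> \<le> exp (th * (real r + 2 * real u)) * a1 ^ (2 * l)"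
      using a1 by (intro mult_left_mono power_mono) auto
    finally have "4 * (D * S) \<le> (4 * exp (th * (real r + 2 * real u))) * a1 ^ (2 * l)" by simp
    also have "\<dots> \<le> a2 * a1 ^ (2 * l)" using a2 a1p by (intro mult_right_mono) auto
    finally show ?thesis .
  qed
  \<comment> \<open>\<open>M * lA\<close> is exactly \<open>X * lb\<close>; the other
    \<open>m + 1\<close> units cost at most \<open>lb / 6\<close> each.\<close>
  have ml: "real l * lA \<le> X * lb + (real m + 1) * lb / 6"
  proof -
    have "real l * lA \<le> (real M + real m + 1) * lA" using lM lA1 by (intro mult_right_mono) auto
    also have "\<dots> = X * lb + (real m + 1) * lA" using MX by (simp add: algebra_simps)
    also have "(real m + 1) * lA \<le> (real m + 1) * (lb / 6)" using lb6 by (intro mult_left_mono) auto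
    finally show ?thesis by simp
  qed
  have small: "4 * D * S * real_of_int B * real_of_int b ^ l * \<bar>z\<bar> ^ (l + m + 1) \<le> 1"
  proof -
    let ?E = "a2 * a1 ^ (2 * l) * real_of_int B * \<bar>real_of_int a\<bar> ^ (l + m + 1)"
    have Ep: "?E > 0" using a2p a1p Bp aa by auto
    have "ln ?E = la2 + real (2 * l) * la1 + lB + real (l + m + 1) * laa"
      using a2p a1p Bp a by (simp add: ln_mult ln_realpow la2_def la1_def lB_def laa_def algebra_simps)
    also have "\<dots> \<le> (la2 + laa) + lB + 2 * (real l * lA)"
    proof -
      have "(real l + real m) * laa \<le> (2 * real l) * laa" using lM laa by (intro mult_right_mono) auto
      then show ?thesis by (simp add: lA_def algebra_simps)
    qed
    \<comment> \<open>With \<open>V = X * lb\<close> and \<open>W = (m + 1) * lb\<close>, the three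
      terms are at most \<open>V / 6\<close>, \<open>V / 2\<close> and \<open>2 * V + W / 3\<close>.
      Their total \<open>8 * V / 3 + W / 3\<close> is at most \<open>W\<close> exactly because
      \<open>4 * V \<le> W\<close>.\<close>
    also have "\<dots> \<le> (real m + 1) * lb"
    proof -
      have "4 * X * lb \<le> (real m + 1) * lb" using m1 lbp by (intro mult_right_mono) auto
      moreover have "(X - 1/2) * lb = X * lb - lb / 2" "(2 * X - 1) * lb = 2 * (X * lb) - lb"
        by (simp_all add: algebra_simps)
      moreover have "la2' + lB + 2 * L \<le> W"
        if "4 * V \<le> W" "6 * la2' \<le> V - lb / 2" "4 * lB \<le> 2 * V - lb" "L \<le> V + W / 6"
        for V W L la2' :: real using that lbp by linarith
      ultimately show ?thesis using Xa2' XB' ml by (simp only: mult.assoc)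
    qed
    also have "\<dots> = ln (real_of_int b ^ (m + 1))" using bp by (simp add: ln_mult ln_realpow lb_def algebra_simps)
    finally have E: "?E \<le> real_of_int b ^ (m + 1)" using Ep bp by (subst (asm) ln_le_cancel_iff) auto
    have "\<bar>z\<bar> ^ (l + m + 1) = \<bar>real_of_int a\<bar> ^ (l + m + 1) / (real_of_int b ^ l * real_of_int b ^ (m + 1))"
      using bp by (simp add: z_def power_divide abs_divide power_add)
    then have "4 * D * S * real_of_int B * real_of_int b ^ l * \<bar>z\<bar> ^ (l + m + 1)
       = 4 * (D * S) * real_of_int B * \<bar>real_of_int a\<bar> ^ (l + m + 1) / real_of_int b ^ (m + 1)"
      using bp by simp
    also have "\<dots> \<le> ?E / real_of_int b ^ (m + 1)"
      using DS Bp bp by (intro divide_right_mono mult_right_mono) auto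
    also have "\<dots> \<le> 1" using E bp by simp
    finally show ?thesis .
  qed
  have main: "1 / (2 * D * S * real_of_int B * real_of_int b ^ l) \<le> \<bar>phi (\<beta> - \<alpha>) \<alpha> z - y\<bar>"
    by (rule pade_lower_bound[OF ab b B lM(1) z_def z2 y_def D1 Dden Dnum S small neq])
  have "2 * D * S * real_of_int b ^ l \<le> real_of_int b ^ M * (a1 ^ 18 * \<bar>real_of_int a\<bar> ^ 17) ^ M"
  proof -
    let ?E = "a2 * a1 ^ (2 * l) * real_of_int b ^ l"
    have Ep: "?E > 0" using a2p a1p bp by auto
    have "2 * D * S \<le> a2 * a1 ^ (2 * l)"
      using DS mult_nonneg_nonneg[of D S] D1 S(2) by linarith
    then have "2 * D * S * real_of_int b ^ l \<le> ?E" using bp by (intro mult_right_mono) auto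
    also have "ln ?E \<le> real M * lb + real M * (18 * la1 + 17 * laa)"
    proof -
      have "ln ?E = la2 + 2 * (real l * la1) + real l * lb"
        using a2p a1p bp by (simp add: ln_mult ln_realpow la2_def la1_def lb_def)
      also have "\<dots> \<le> (la2 + laa) + 2 * (real l * lA) + (real M + real m + 1) * lb"
      proof -
        have "real l * la1 \<le> real l * lA" using laa by (intro mult_left_mono) (auto simp: lA_def)
        moreover have "real l * lb \<le> (real M + real m + 1) * lb"
          using lM lbp by (intro mult_right_mono) auto
        ultimately show ?thesis using laa by linarith
      qed
      \<comment> \<open>Now \<open>W \<le> 5 * V\<close>, from
        \<open>m + 1 \<le> 4 * X + 1 \<le> 5 * X\<close>. Apart from \<open>M * lb\<close> the terms
        add up to at most \<open>53 * V / 6\<close>, below \<open>17 * V\<close>.\<close>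
      also have "\<dots> \<le> real M * lb + 17 * (X * lb)"
      proof -
        have "(real m + 1) * lb \<le> (5 * X) * lb" using m1 X lbp by (intro mult_right_mono) auto
        moreover have "(X - 1/2) * lb = X * lb - lb / 2" "(real M + real m + 1) * lb = real M * lb + (real m + 1) * lb"
          by (simp_all add: algebra_simps)
        moreover have "X * lb \<ge> 0" using X lbp by simp
        moreover have "la2' + 2 * L + (Mb + W) \<le> Mb + 17 * V"
          if "W \<le> 5 * V" "V \<ge> 0" "6 * la2' \<le> V - lb / 2" "L \<le> V + W / 6"
          for V W L Mb la2' :: real using that lbp by linarith
        ultimately show ?thesis using Xa2' ml by (simp only: mult.assoc)
      qed
      also have "17 * (X * lb) = real M * (17 * lA)" using MX by simp
      also have "\<dots> \<le> real M * (18 * la1 + 17 * laa)"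
        using la1 by (intro mult_left_mono) (auto simp: lA_def)
      finally show ?thesis by simp
    qed
    then have "ln ?E \<le> ln (real_of_int b ^ M * (a1 ^ 18 * \<bar>real_of_int a\<bar> ^ 17) ^ M)"
      using bp a1p a by (simp add: ln_mult ln_realpow lb_def la1_def laa_def)
    then have "?E \<le> real_of_int b ^ M * (a1 ^ 18 * \<bar>real_of_int a\<bar> ^ 17) ^ M"
      using Ep bp a1p aa by (subst (asm) ln_le_cancel_iff) auto
    finally show ?thesis .
  qed
  then have "real_of_int B * (2 * D * S * real_of_int b ^ l)
      \<le> real_of_int B * (real_of_int b ^ M * (a1 ^ 18 * \<bar>real_of_int a\<bar> ^ 17) ^ M)"
    using Bp by (intro mult_left_mono) auto
  then have "1 / (real_of_int B * (real_of_int b ^ M * (a1 ^ 18 * \<bar>real_of_int a\<bar> ^ 17) ^ M))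
     \<le> 1 / (real_of_int B * (2 * D * S * real_of_int b ^ l))"
    using Bp bp D1 S a1p a by (intro divide_left_mono mult_pos_pos) auto
  also have "\<dots> \<le> \<bar>phi (\<beta> - \<alpha>) \<alpha> z - y\<bar>" using main by (simp add: mult_ac)
  finally show ?thesis by (simp add: \<alpha>_def \<beta>_def z_def y_def mult_ac)
qed

section \<open>From the condition on M to the rescaled parameter X\<close>

theorem theorem4:
  fixes r0 s0 r s u v d :: nat
    and th vth cth cvth :: real
    and a b B :: int and t :: real
  assumes r0_pos: "r0 > 0" and s0_pos: "s0 > 0" and cop0: "coprime r0 s0"
    and r_pos: "r > 0" and s_pos: "s > 0" and cop: "coprime r s"
    and u_pos: "u > 0" and v_pos: "v > 0" and copuv: "coprime u v"
    and sum_uv: "real u / real v = real r0 / real s0 + real r / real s"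
    and d_def: "s0 * s = d * v"
    and theta: "th > 1" and vtheta: "vth > 1"
    and ctheta: "cth \<ge> 2" "\<forall>x\<ge>cth. real (prime_pi x) \<le> th * x / ln x"
    and cvtheta: "cvth > 0" "\<forall>n::nat. real n \<ge> cvth \<longrightarrow> (real n + 1)^2 < vth ^ n"
    and a_nz: "a \<noteq> 0" and b_ge: "b \<ge> 1" and B_ge: "B \<ge> 1" and t_ge: "t \<ge> 0"
  shows "let
      \<alpha>0 = real r0 / real s0; \<alpha> = real r / real s;
      dt = d div gcd d s0;
      a1 = (vth * real d * real s0 * eps s0 * eps v) powr (1/4) * real dt * eps s
             * exp (th * (real s0 / 2 + real s + 2 * real v));
      a2 = 4 * real dt * eps s * exp (th * (real r + real s + 2 * real r0 + 2 * real u));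
      M0 = ln (real_of_int b) / ln (a1 * \<bar>real_of_int a\<bar>) *
           Max {6 * ln (a2 * \<bar>real_of_int a\<bar>) / ln (real_of_int b) + 1/2,
                (4 * t + 1) / 2,
                1/4 * (ln (real_of_int b) / ln (a1 * \<bar>real_of_int a\<bar>)),
                (1 + max cth (max cvth 4)) / 2}
    in real_of_int b \<ge> (a1 * \<bar>real_of_int a\<bar>) ^ 6 \<longrightarrow>
       real_of_int B \<le> real_of_int b powr t \<longrightarrow>
       (\<forall>(n::int) (M::int). real_of_int M \<ge> M0 \<longrightarrow>
          \<bar>phi \<alpha>0 \<alpha> (real_of_int a / real_of_int b)
             - real_of_int n / (real_of_int B * real_of_int b powi M)\<bar>
          \<ge> 1 / (real_of_int B * real_of_int b powi M * (a1 ^ 18 * \<bar>real_of_int a\<bar> ^ 17) powi M))"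
proof -
  define \<alpha>0 \<alpha> dt where "\<alpha>0 = real r0 / real s0" and "\<alpha> = real r / real s" and "dt = d div gcd d s0"
  define a1 where "a1 = (vth * real d * real s0 * eps s0 * eps v) powr (1/4) * real dt * eps s
             * exp (th * (real s0 / 2 + real s + 2 * real v))"
  define a2 where "a2 = 4 * real dt * eps s * exp (th * (real r + real s + 2 * real r0 + 2 * real u))"
  define lb lA where "lb = ln (real_of_int b)" and "lA = ln (a1 * \<bar>real_of_int a\<bar>)"
  define Mx where "Mx = Max {6 * ln (a2 * \<bar>real_of_int a\<bar>) / lb + 1/2, (4 * t + 1) / 2,
                1/4 * (lb / lA), (1 + max cth (max cvth 4)) / 2}"
  have d: "d > 0" using d_def s0_pos s_pos by (cases d) auto
  then have dt: "real dt \<ge> 1"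
    unfolding dt_def using dvd_div_eq_0_iff[of "gcd d s0" d] by (simp add: Suc_le_eq)
  have dteps: "real dt * eps s \<ge> 1" using mult_mono[OF dt eps_ge_1[of s]] by simp
  \<comment> \<open>The product in front of the exponential is at least 1, and
    \<open>s0 \<ge> 1\<close> bounds the exponent from below.\<close>
  have a1: "a1 \<ge> exp (th * (1/2 + real s + 2 * real v))"
  proof -
    have "1 \<le> vth * real d * real s0 * eps s0 * eps v"
    proof -
      have "1 * 1 * 1 * 1 * 1 \<le> vth * real d * real s0 * eps s0 * eps v"
        using vtheta d s0_pos eps_ge_1[of s0] eps_ge_1[of v]
        by (intro mult_mono mult_nonneg_nonneg) auto
      then show ?thesis by simp
    qed
    then have "1 \<le> (vth * real d * real s0 * eps s0 * eps v) powr (1/4)"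
      by (intro ge_one_powr_ge_zero) auto
    from mult_mono[OF this dteps] have "1 \<le> (vth * real d * real s0 * eps s0 * eps v) powr (1/4) * real dt * eps s"
      by (simp add: mult.assoc)
    from mult_right_mono[OF this, of "exp (th * (real s0 / 2 + real s + 2 * real v))"]
    have "exp (th * (real s0 / 2 + real s + 2 * real v)) \<le> a1" by (simp add: a1_def)
    moreover have "th * (1/2 + real s + 2 * real v) \<le> th * (real s0 / 2 + real s + 2 * real v)"
      using theta s0_pos by (intro mult_left_mono) auto
    ultimately show ?thesis by (meson exp_le_cancel_iff order_trans)
  qed
  have a2: "a2 \<ge> 4 * exp (th * (real r + 2 * real u))"
  proof -
    have "th * (real r + 2 * real u) \<le> th * (real r + real s + 2 * real r0 + 2 * real u)"
      using theta by (intro mult_left_mono) auto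
    then have "1 * exp (th * (real r + 2 * real u))
        \<le> (real dt * eps s) * exp (th * (real r + real s + 2 * real r0 + 2 * real u))"
      using dteps by (intro mult_mono) auto
    then show ?thesis by (simp add: a2_def mult_ac)
  qed
  have "\<bar>phi \<alpha>0 \<alpha> (real_of_int a / real_of_int b) - real_of_int n / (real_of_int B * real_of_int b powi M)\<bar>
          \<ge> 1 / (real_of_int B * real_of_int b powi M * (a1 ^ 18 * \<bar>real_of_int a\<bar> ^ 17) powi M)"
    if bA: "real_of_int b \<ge> (a1 * \<bar>real_of_int a\<bar>) ^ 6" and Bt: "real_of_int B \<le> real_of_int b powr t"
      and M: "real_of_int M \<ge> lb / lA * Mx" for n M :: int
  proof -
    have aa: "\<bar>real_of_int a\<bar> \<ge> 1" using a_nz by linarith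
    have "1 < exp (th * (1/2 + real s + 2 * real v))"
      using theta by (simp add: add_pos_nonneg)
    then have "1 < a1" using a1 by linarith
    then have A1: "1 < a1 * \<bar>real_of_int a\<bar>" using aa mult_less_le_imp_less[of 1 a1 1] by simp
    then have lA: "lA > 0" by (simp add: lA_def)
    have "1 < real_of_int b" using bA one_less_power[OF A1, of 6] by simp
    then have lb: "lb > 0" by (simp add: lb_def)
    \<comment> \<open>Dividing \<open>M\<close> by the prefactor \<open>lb / lA\<close> of the
      threshold turns the assumption into \<open>Mx \<le> X\<close>, and each member of the maximum
      yields one bound. The last member gives both \<open>5/2 \<le> X\<close>, from its entry 4, and
      \<open>cth \<le> 2 * X - 1\<close>.\<close>
    define X where "X = real_of_int M * lA / lb"
    have "Mx \<le> X" using M lA lb by (simp add: X_def field_simps)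
    then have X: "6 * ln (a2 * \<bar>real_of_int a\<bar>) / lb + 1/2 \<le> X" "(4 * t + 1) / 2 \<le> X"
        "(1 + max cth (max cvth 4)) / 2 \<le> X"
      unfolding Mx_def by auto
    have X52: "5/2 \<le> X" and Xc: "cth \<le> 2 * X - 1" using X(3) by auto
    have "real_of_int M * lA = X * lb" using lb by (simp add: X_def)
    moreover have "X * lb > 0" using X52 lb by simp
    ultimately have "real_of_int M > 0" using lA by (metis zero_less_mult_pos2)
    \<comment> \<open>As \<open>M\<close> is positive, its integer powers are powers with a natural
      exponent.\<close>
    then obtain M' where M': "M = int M'" by (metis less_imp_le of_int_0_less_iff zero_le_imp_eq_int)
    have MX: "real M' * lA = X * lb" using \<open>real_of_int M * lA = X * lb\<close> M' by simp
    have Xa2: "6 * ln (a2 * \<bar>real_of_int a\<bar>) \<le> (X - 1/2) * lb"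
      using X(1) lb by (simp add: field_simps)
    have "ln (real_of_int B) \<le> t * lb"
    proof -
      have "ln (real_of_int B) \<le> ln (real_of_int b powr t)"
        using Bt B_ge b_ge by (subst ln_le_cancel_iff) auto
      then show ?thesis using b_ge by (simp add: lb_def ln_powr)
    qed
    moreover have "4 * t * lb \<le> (2 * X - 1) * lb" using X(2) lb by (intro mult_right_mono) auto
    ultimately have XB: "4 * ln (real_of_int B) \<le> (2 * X - 1) * lb" by simp
    have lt: "real r / real s < real u / real v"
      using sum_uv r0_pos s0_pos by simp
    have "real u / real v - real r / real s = \<alpha>0" using sum_uv by (simp add: \<alpha>0_def)
    then show ?thesis
      using phi_fraction_lower_bound[OF r_pos s_pos u_pos v_pos lt theta ctheta(2) a_nz b_ge B_ge a1 a2 bA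
          MX[unfolded lA_def lb_def] X52 Xc Xa2[unfolded lb_def] XB[unfolded lb_def], of n]
      by (simp add: M' \<alpha>_def)
  qed
  then show ?thesis
    unfolding Let_def a1_def a2_def \<alpha>0_def \<alpha>_def dt_def lb_def lA_def Mx_def by blast
qed

end
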